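(* Let $\mathcal M$ be a GW*-algebra on a dense subspace $\mathcal D$ of a Hilbert space $\mathcal H$ such that the strong*-closure of $\overline{\mathcal M_b}$ equals $(\mathcal M'_{\rm w})'$, and let $E$ be a projection with $E\restriction_{\mathcal D}\in\mathcal M$. Then the closure of $\mathcal M_E=\{EX\restriction_{E\mathcal D}:X\in\mathcal M\}$ is a GW*-algebra on $\widetilde{\mathcal D}(\mathcal M_E)$.
   Context: $\mathcal L^\dagger(\mathcal D,\mathcal H)$: linear operators $X$ with $D(X)=\mathcal D$, $D(X^* )\supseteq\mathcal D$, involution $X^\dagger=X^*\restriction_{\mathcal D}$; $\mathcal L^\dagger(\mathcal D)$: those $X$ with $X\mathcal D\subset\mathcal D$, $X^\dagger\mathcal D\subset\mathcal D$; it is a *-algebra. An O*-algebra on $\mathcal D$ is a *-subalgebra of $\mathcal L^\dagger(\mathcal D)$. Graph topology $t_{\mathcal M}$ on $\mathcal D$: given by seminorms $\|\cdot\|$ and $\xi\mapsto\|X\xi\|$, $X\in\mathcal M$; $\widetilde{\mathcal D}(\mathcal M)$ denotes the completion of $\mathcal D[t_{\mathcal M}]$ (realized in $\mathcal H$), the closure of $\mathcal M$ is $\widetilde{\mathcal M}=\{\overline X\restriction_{\widetilde{\mathcal D}(\mathcal M)}\}$, and $\mathcal M$ is closed if $\mathcal D[t_{\mathcal M}]$ is complete. Weak commutant $\mathcal M'_{\rm w}=\{C\in\mathcal B(\mathcal H):\langle CX\xi,\eta\rangle=\langle C\xi,X^\dagger\eta\rangle\ \forall X\in\mathcal M,\ \xi,\eta\in\mathcal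 D\}$; $\mathcal M''_{{\rm w}c}=\{X\in\mathcal L^\dagger(\mathcal D):\langle CX\xi,\eta\rangle=\langle C\xi,X^\dagger\eta\rangle\ \forall C\in\mathcal M'_{\rm w},\xi,\eta\in\mathcal D\}$. A closed O*-algebra $\mathcal M$ on $\mathcal D$ is a GW*-algebra if $\mathcal M'_{\rm w}\mathcal D\subset\mathcal D$ and $\mathcal M=\mathcal M''_{{\rm w}c}$. $\mathcal M_b$ is the set of bounded elements of $\mathcal M$, $\overline{\mathcal M_b}=\{\overline X:X\in\mathcal M_b\}$; the strong*-topology on $\mathcal B(\mathcal H)$ is given by seminorms $A\mapsto\|A\xi\|+\|A^*\xi\|$. *)

theory Defs
  imports "HOL-Analysis.Analysis"
begin

text \<open>HOL-Analysis has only real inner product spaces, so we introduce complex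
Hilbert spaces as a type class: a complete normed space with a complex scalar
multiplication (compatible with the real one) and a complex inner product
(linear in the first argument, conjugate-linear in the second) inducing the norm.\<close>

class chilbert = real_normed_vector + complete_space +
  fixes scaleC :: "complex \<Rightarrow> 'a \<Rightarrow> 'a"
    and cinner :: "'a \<Rightarrow> 'a \<Rightarrow> complex"
  assumes scaleC_of_real: "scaleC (complex_of_real r) x = scaleR r x"
    and scaleC_add_right: "scaleC a (x + y) = scaleC a x + scaleC a y"
    and scaleC_add_left: "scaleC (a + b) x = scaleC a x + scaleC b x"
    and scaleC_scaleC: "scaleC a (scaleC b x) = scaleC (a * b) x"
    and scaleC_one: "scaleC 1 x = x"
    and cinner_commute: "cinner x y = cnj (cinner y x)"
    and cinner_add_left: "cinner (x + y) z = cinner x z + cinner y z"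
    and cinner_scaleC_left: "cinner (scaleC c x) y = c * cinner x y"
    and cinner_self_real: "Im (cinner x x) = 0 \<and> Re (cinner x x) \<ge> 0"
    and cinner_self_eq_0: "cinner x x = 0 \<longleftrightarrow> x = 0"
    and norm_cinner: "norm x = sqrt (Re (cinner x x))"

definition csubspace :: "'a::chilbert set \<Rightarrow> bool" where
  "csubspace S \<longleftrightarrow> 0 \<in> S \<and> (\<forall>x\<in>S. \<forall>y\<in>S. x + y \<in> S) \<and> (\<forall>c. \<forall>x\<in>S. scaleC c x \<in> S)"

text \<open>A Hilbert space inside the ambient type: a closed subspace.\<close>
definition hilbert_sub :: "'a::chilbert set \<Rightarrow> bool" where
  "hilbert_sub K \<longleftrightarrow> csubspace K \<and> closed K"

definition dense_in :: "'a::chilbert set \<Rightarrow> 'a set \<Rightarrow> bool" where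
  "dense_in D K \<longleftrightarrow> D \<subseteq> K \<and> K \<subseteq> closure D"

definition clinear_on :: "'a::chilbert set \<Rightarrow> ('a \<Rightarrow> 'a) \<Rightarrow> bool" where
  "clinear_on D f \<longleftrightarrow> (\<forall>x\<in>D. \<forall>y\<in>D. f (x + y) = f x + f y) \<and>
     (\<forall>c. \<forall>x\<in>D. f (scaleC c x) = scaleC c (f x))"

text \<open>Operators with domain \<open>D\<close> are represented by functions vanishing outside \<open>D\<close>.\<close>
definition ext_on :: "'a::chilbert set \<Rightarrow> ('a \<Rightarrow> 'a) \<Rightarrow> bool" where
  "ext_on D f \<longleftrightarrow> (\<forall>x. x \<notin> D \<longrightarrow> f x = 0)"

definition restr :: "'a::chilbert set \<Rightarrow> ('a \<Rightarrow> 'a) \<Rightarrow> 'a \<Rightarrow> 'a" where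
  "restr D f = (\<lambda>x. if x \<in> D then f x else 0)"

definition Ldag :: "'a::chilbert set \<Rightarrow> ('a \<Rightarrow> 'a) set" where
  "Ldag D = {X. ext_on D X \<and> clinear_on D X \<and> X ` D \<subseteq> D \<and>
      (\<forall>\<eta>\<in>D. \<exists>\<zeta>\<in>D. \<forall>\<xi>\<in>D. cinner (X \<xi>) \<eta> = cinner \<xi> \<zeta>)}"

definition dagger :: "'a::chilbert set \<Rightarrow> ('a \<Rightarrow> 'a) \<Rightarrow> 'a \<Rightarrow> 'a" where
  "dagger D X = (\<lambda>\<eta>. if \<eta> \<in> D then (THE \<zeta>. \<zeta> \<in> D \<and> (\<forall>\<xi>\<in>D. cinner (X \<xi>) \<eta> = cinner \<xi> \<zeta>)) else 0)"

definition Ostar :: "'a::chilbert set \<Rightarrow> 'a set \<Rightarrow> ('a \<Rightarrow> 'a) set \<Rightarrow> bool" where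
  "Ostar K D M \<longleftrightarrow> hilbert_sub K \<and> csubspace D \<and> dense_in D K \<and> M \<subseteq> Ldag D \<and> M \<noteq> {} \<and>
     (\<forall>X\<in>M. \<forall>Y\<in>M. (\<lambda>x. X x + Y x) \<in> M) \<and>
     (\<forall>c. \<forall>X\<in>M. (\<lambda>x. scaleC c (X x)) \<in> M) \<and>
     (\<forall>X\<in>M. \<forall>Y\<in>M. (\<lambda>x. X (Y x)) \<in> M) \<and>
     (\<forall>X\<in>M. dagger D X \<in> M)"

text \<open>Cauchy filters (= Cauchy nets) in \<open>D[t_M]\<close>.\<close>
definition tM_cauchy :: "('a::chilbert \<Rightarrow> 'a) set \<Rightarrow> 'a set \<Rightarrow> 'a filter \<Rightarrow> bool" where
  "tM_cauchy M D F \<longleftrightarrow> F \<noteq> bot \<and> eventually (\<lambda>x. x \<in> D) F \<and>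
     (\<forall>e>0. eventually (\<lambda>(x, y). norm (x - y) < e) (F \<times>\<^sub>F F)) \<and>
     (\<forall>X\<in>M. \<forall>e>0. eventually (\<lambda>(x, y). norm (X x - X y) < e) (F \<times>\<^sub>F F))"

definition closed_O :: "('a::chilbert \<Rightarrow> 'a) set \<Rightarrow> 'a set \<Rightarrow> bool" where
  "closed_O M D \<longleftrightarrow> (\<forall>F. tM_cauchy M D F \<longrightarrow>
      (\<exists>\<xi>\<in>D. ((\<lambda>x. x) \<longlongrightarrow> \<xi>) F \<and> (\<forall>X\<in>M. (X \<longlongrightarrow> X \<xi>) F)))"

text \<open>The completion of \<open>D[t_M]\<close> realized in the ambient Hilbert space.\<close>
definition Dtilde :: "('a::chilbert \<Rightarrow> 'a) set \<Rightarrow> 'a set \<Rightarrow> 'a set" where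
  "Dtilde M D = {\<xi>. \<exists>F. tM_cauchy M D F \<and> ((\<lambda>x. x) \<longlongrightarrow> \<xi>) F}"

text \<open>The closure of \<open>X\<close> restricted to \<open>Dtilde M D\<close>.\<close>
definition closure_op :: "('a::chilbert \<Rightarrow> 'a) set \<Rightarrow> 'a set \<Rightarrow> ('a \<Rightarrow> 'a) \<Rightarrow> 'a \<Rightarrow> 'a" where
  "closure_op M D X = (\<lambda>\<xi>. if \<xi> \<in> Dtilde M D then
      (THE \<zeta>. \<exists>F. tM_cauchy M D F \<and> ((\<lambda>x. x) \<longlongrightarrow> \<xi>) F \<and> (X \<longlongrightarrow> \<zeta>) F) else 0)"

definition closure_alg :: "('a::chilbert \<Rightarrow> 'a) set \<Rightarrow> 'a set \<Rightarrow> ('a \<Rightarrow> 'a) set" where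
  "closure_alg M D = closure_op M D ` M"

definition bop :: "'a::chilbert set \<Rightarrow> ('a \<Rightarrow> 'a) \<Rightarrow> bool" where
  "bop K A \<longleftrightarrow> ext_on K A \<and> clinear_on K A \<and> A ` K \<subseteq> K \<and>
     (\<exists>c. \<forall>x\<in>K. norm (A x) \<le> c * norm x)"

definition badj :: "'a::chilbert set \<Rightarrow> ('a \<Rightarrow> 'a) \<Rightarrow> 'a \<Rightarrow> 'a" where
  "badj K A = (\<lambda>\<eta>. if \<eta> \<in> K then (THE \<zeta>. \<zeta> \<in> K \<and> (\<forall>\<xi>\<in>K. cinner (A \<xi>) \<eta> = cinner \<xi> \<zeta>)) else 0)"

definition is_projection :: "'a::chilbert set \<Rightarrow> ('a \<Rightarrow> 'a) \<Rightarrow> bool" where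
  "is_projection K E \<longleftrightarrow> bop K E \<and> (\<forall>x. E (E x) = E x) \<and> badj K E = E"

definition bcomm :: "'a::chilbert set \<Rightarrow> ('a \<Rightarrow> 'a) set \<Rightarrow> ('a \<Rightarrow> 'a) set" where
  "bcomm K S = {A. bop K A \<and> (\<forall>C\<in>S. \<forall>x\<in>K. A (C x) = C (A x))}"

definition sstar_closure :: "'a::chilbert set \<Rightarrow> ('a \<Rightarrow> 'a) set \<Rightarrow> ('a \<Rightarrow> 'a) set" where
  "sstar_closure K S = {A. bop K A \<and> (\<forall>V e. finite V \<and> V \<subseteq> K \<and> e > 0 \<longrightarrow>
      (\<exists>B\<in>S. \<forall>\<xi>\<in>V. norm (A \<xi> - B \<xi>) + norm (badj K (\<lambda>x. A x - B x) \<xi>) < e))}"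

definition wcomm :: "'a::chilbert set \<Rightarrow> 'a set \<Rightarrow> ('a \<Rightarrow> 'a) set \<Rightarrow> ('a \<Rightarrow> 'a) set" where
  "wcomm K D M = {C. bop K C \<and> (\<forall>X\<in>M. \<forall>\<xi>\<in>D. \<forall>\<eta>\<in>D.
      cinner (C (X \<xi>)) \<eta> = cinner (C \<xi>) (dagger D X \<eta>))}"

definition wbicomm_c :: "'a::chilbert set \<Rightarrow> 'a set \<Rightarrow> ('a \<Rightarrow> 'a) set \<Rightarrow> ('a \<Rightarrow> 'a) set" where
  "wbicomm_c K D M = {X \<in> Ldag D. \<forall>C\<in>wcomm K D M. \<forall>\<xi>\<in>D. \<forall>\<eta>\<in>D.
      cinner (C (X \<xi>)) \<eta> = cinner (C \<xi>) (dagger D X \<eta>)}"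

definition GWstar :: "'a::chilbert set \<Rightarrow> 'a set \<Rightarrow> ('a \<Rightarrow> 'a) set \<Rightarrow> bool" where
  "GWstar K D M \<longleftrightarrow> Ostar K D M \<and> closed_O M D \<and>
     (\<forall>C\<in>wcomm K D M. C ` D \<subseteq> D) \<and> M = wbicomm_c K D M"

definition Mb :: "'a::chilbert set \<Rightarrow> ('a \<Rightarrow> 'a) set \<Rightarrow> ('a \<Rightarrow> 'a) set" where
  "Mb D M = {X \<in> M. \<exists>c. \<forall>\<xi>\<in>D. norm (X \<xi>) \<le> c * norm \<xi>}"

definition bclos :: "'a::chilbert set \<Rightarrow> 'a set \<Rightarrow> ('a \<Rightarrow> 'a) \<Rightarrow> 'a \<Rightarrow> 'a" where
  "bclos K D X = (THE A. bop K A \<and> (\<forall>\<xi>\<in>D. A \<xi> = X \<xi>))"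

definition ME :: "'a::chilbert set \<Rightarrow> ('a \<Rightarrow> 'a) \<Rightarrow> ('a \<Rightarrow> 'a) set \<Rightarrow> ('a \<Rightarrow> 'a) set" where
  "ME D E M = (\<lambda>X. restr (E ` D) (\<lambda>x. E (X x))) ` M"

end

theory Submission
  imports Defs
begin

text \<open>
  On \<open>E D\<close> the graph topologies of \<open>M\<close> and of \<open>M\<^sub>E\<close> coincide, since
  \<open>\<parallel>X \<xi>\<parallel>\<^sup>2 = \<langle>E X\<^sup>\<dagger> X \<xi>, \<xi>\<rangle>\<close>, and \<open>E\<close> is continuous, so \<open>M\<^sub>E\<close> is already closed on \<open>E D\<close>.
  An element \<open>X\<close> of the weak bicommutant of \<open>M\<^sub>E\<close> gives \<open>X E\<close> in the weak bicommutant of \<open>M\<close>,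
  which is \<open>M\<close>. For the invariance of \<open>E D\<close> under an operator \<open>C\<close> in the weak commutant of \<open>M\<^sub>E\<close>, put
  \<open>N = (M'\<^sub>w)'\<close>. By the density hypothesis \<open>C\<close> commutes with \<open>E N E\<close>, hence it is the restriction of
  an operator in \<open>N'\<close>. Projections onto closed graphs show that \<open>N' = M'\<^sub>w\<close>, and \<open>M'\<^sub>w\<close> maps \<open>D\<close> into \<open>D\<close>.
\<close>

text \<open>Invariance of E D under an operator C of the weak commutant of M_E is the obstacle: C is
  known only through inner products with vectors of E D, and nothing in its definition places C
  \<xi> in the domain. The one source of domain invariance is the GW*-property of M, so C has to be
  lifted to an element of M'_w. Lifting is a question about bounded operators, but elements of N
  need not map D into D, so the defining relation of C cannot be applied to them directly. It
  applies to the bounded elements of M, and strong* approximation carries the resulting commutation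
  over to N. The lift lands in N'. To return to M'_w no bicommutant theorem is invoked: for each X
  in M the closed graph of X reduces the diagonal action of M'_w, so its projection is a 2 x 2
  matrix over N, and elements of N' commute with every entry.\<close>

section \<open>Complex Hilbert spaces\<close>

lemma scaleC_zero_left [simp]: "scaleC 0 (x::'a::chilbert) = 0"
  using scaleC_of_real[of 0 x] by simp

lemma scaleC_zero_right [simp]: "scaleC c (0::'a::chilbert) = 0"
  using scaleC_add_right[of c 0 "0::'a"] by simp

lemma scaleC_minus_one: "scaleC (-1) (x::'a::chilbert) = - x"
  using scaleC_of_real[of "-1" x] by simp

lemma scaleC_minus_right: "scaleC c (- (x::'a::chilbert)) = - scaleC c x"
  using scaleC_add_right[of c x "-x"] by (simp add: eq_neg_iff_add_eq_0 add.commute)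

lemma scaleC_diff_right: "scaleC c ((x::'a::chilbert) - y) = scaleC c x - scaleC c y"
  using scaleC_add_right[of c x "-y"] by (simp add: scaleC_minus_right)

lemma cinner_scaleC_right: "cinner (x::'a::chilbert) (scaleC c y) = cnj c * cinner x y"
  by (metis cinner_commute cinner_scaleC_left complex_cnj_mult)

lemma cinner_add_right: "cinner (x::'a::chilbert) (y + z) = cinner x y + cinner x z"
  by (metis cinner_commute cinner_add_left complex_cnj_add)

lemma cinner_zero_left [simp]: "cinner 0 (y::'a::chilbert) = 0"
  using cinner_add_left[of 0 0 y] by simp

lemma cinner_zero_right [simp]: "cinner (y::'a::chilbert) 0 = 0"
  using cinner_add_right[of y 0 0] by simp

lemma cinner_minus_left: "cinner (- x) (y::'a::chilbert) = - cinner x y"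
  using cinner_add_left[of x "-x" y] by (simp add: eq_neg_iff_add_eq_0 add.commute)

lemma cinner_minus_right: "cinner (y::'a::chilbert) (- x) = - cinner y x"
  using cinner_add_right[of y x "-x"] by (simp add: eq_neg_iff_add_eq_0 add.commute)

lemma cinner_diff_left: "cinner (x - z) (y::'a::chilbert) = cinner x y - cinner z y"
  using cinner_add_left[of x "-z" y] by (simp add: cinner_minus_left)

lemma cinner_diff_right: "cinner (y::'a::chilbert) (x - z) = cinner y x - cinner y z"
  using cinner_add_right[of y x "-z"] by (simp add: cinner_minus_right)

lemma cinner_self: "cinner (x::'a::chilbert) x = complex_of_real ((norm x)\<^sup>2)"
  using cinner_self_real[of x] by (simp add: norm_cinner complex_eq_iff)

lemma norm_sq: "(norm (x::'a::chilbert))\<^sup>2 = Re (cinner x x)"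
  using cinner_self[of x] by simp

lemma norm_scaleC: "norm (scaleC c (x::'a::chilbert)) = cmod c * norm x"
proof -
  have "(norm (scaleC c x))\<^sup>2 = (cmod c * norm x)\<^sup>2"
  proof -
    have "cinner (scaleC c x) (scaleC c x) = (c * cnj c) * cinner x x"
      by (simp add: cinner_scaleC_left cinner_scaleC_right)
    also have "\<dots> = complex_of_real ((cmod c * norm x)\<^sup>2)"
      by (simp add: cinner_self complex_norm_square[symmetric] power_mult_distrib)
    finally show ?thesis by (simp add: norm_sq[of "scaleC c x"])
  qed
  then show ?thesis by (simp add: power2_eq_iff_nonneg)
qed

lemma cinner_Cauchy_Schwarz: "cmod (cinner (x::'a::chilbert) y) \<le> norm x * norm y"
proof (cases "y = 0")
  case False
  \<comment> \<open>\<open>scaleC a y\<close> is the orthogonal projection of \<open>x\<close> to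
    the line of \<open>y\<close>. The inequality is the nonnegativity of the squared length of the
    remainder.\<close>
  define a where "a = cinner x y / complex_of_real ((norm y)\<^sup>2)"
  have ny: "norm y > 0" using False by simp
  have a: "a * complex_of_real ((norm y)\<^sup>2) = cinner x y" using False by (simp add: a_def)
  have yx: "cinner y x = cnj (cinner x y)" by (rule cinner_commute)
  have "cinner (x - scaleC a y) (x - scaleC a y) =
      cinner x x - cnj a * cinner x y - a * cinner y x + a * cnj a * cinner y y"
    by (simp add: cinner_diff_left cinner_diff_right cinner_scaleC_left cinner_scaleC_right algebra_simps)
  also have "\<dots> = cinner x x - a * cinner y x"
    using a by (simp add: cinner_self[of y] algebra_simps)
  also have "\<dots> = complex_of_real ((norm x)\<^sup>2 - (cmod (cinner x y))\<^sup>2 / (norm y)\<^sup>2)"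
    by (simp add: a_def yx cinner_self[of x] complex_norm_square[symmetric])
  finally have "Re (complex_of_real ((norm x)\<^sup>2 - (cmod (cinner x y))\<^sup>2 / (norm y)\<^sup>2)) \<ge> 0"
    using cinner_self_real[of "x - scaleC a y"] by metis
  then have "(cmod (cinner x y))\<^sup>2 \<le> (norm x)\<^sup>2 * (norm y)\<^sup>2"
    using ny by (simp add: field_simps)
  then have "(cmod (cinner x y))\<^sup>2 \<le> (norm x * norm y)\<^sup>2" by (simp add: power_mult_distrib)
  then show ?thesis by (rule power2_le_imp_le) simp
qed simp

lemma bounded_bilinear_cinner: "bounded_bilinear (cinner :: 'a::chilbert \<Rightarrow> 'a \<Rightarrow> complex)"
proof
  show "\<exists>K. \<forall>a b::'a. norm (cinner a b) \<le> norm a * norm b * K"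
    by (rule exI[of _ 1]) (simp add: cinner_Cauchy_Schwarz)
qed (simp_all add: cinner_add_left cinner_add_right cinner_scaleC_left cinner_scaleC_right
      scaleC_of_real[symmetric] scaleR_conv_of_real)

lemma bounded_linear_scaleC: "bounded_linear (scaleC c :: 'a::chilbert \<Rightarrow> 'a)"
proof (rule bounded_linear_intro[of _ "cmod c"])
  show "scaleC c (scaleR r x) = scaleR r (scaleC c x)" for r and x :: 'a
    by (simp add: scaleC_of_real[symmetric] scaleC_scaleC mult.commute)
qed (simp_all add: scaleC_add_right norm_scaleC mult.commute)

lemmas tendsto_cinner = bounded_bilinear.tendsto[OF bounded_bilinear_cinner]
lemmas continuous_on_cinner = bounded_bilinear.continuous_on[OF bounded_bilinear_cinner]

lemma parallelogram: "(norm ((x::'a::chilbert) + y))\<^sup>2 + (norm (x - y))\<^sup>2 = 2 * (norm x)\<^sup>2 + 2 * (norm y)\<^sup>2"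
  unfolding norm_sq by (simp add: cinner_add_left cinner_add_right cinner_diff_left cinner_diff_right)

section \<open>Closed subspaces and orthogonal projections\<close>

lemma csubspace_0: "csubspace S \<Longrightarrow> 0 \<in> S"
  and csubspace_add: "csubspace S \<Longrightarrow> x \<in> S \<Longrightarrow> y \<in> S \<Longrightarrow> x + y \<in> S"
  and csubspace_scaleC: "csubspace S \<Longrightarrow> x \<in> S \<Longrightarrow> scaleC c x \<in> S"
  by (auto simp: csubspace_def)

lemma csubspace_scaleR: "csubspace S \<Longrightarrow> x \<in> S \<Longrightarrow> scaleR r x \<in> S"
  using csubspace_scaleC[of S x "of_real r"] by (simp add: scaleC_of_real)

lemma csubspace_diff: "csubspace S \<Longrightarrow> x \<in> S \<Longrightarrow> y \<in> S \<Longrightarrow> x - y \<in> S"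
  using csubspace_add[of S x "scaleC (-1) y"] csubspace_scaleC[of S y "-1"]
  by (simp add: scaleC_minus_one)

lemma csubspace_closure:
  assumes "csubspace S" shows "csubspace (closure S)"
  unfolding csubspace_def
proof (intro conjI ballI allI)
  show "0 \<in> closure S" using csubspace_0[OF assms] closure_subset by auto
  fix x y assume "x \<in> closure S" "y \<in> closure S"
  then obtain f g where "\<forall>n. f n \<in> S" "f \<longlonglongrightarrow> x" "\<forall>n. g n \<in> S" "g \<longlonglongrightarrow> y"
    by (auto simp: closure_sequential)
  then show "x + y \<in> closure S"
    using csubspace_add[OF assms] by (auto simp: closure_sequential intro!: exI[of _ "\<lambda>n. f n + g n"] tendsto_add)
next
  fix c x assume "x \<in> closure S"
  then obtain f where "\<forall>n. f n \<in> S" "f \<longlonglongrightarrow> x"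
    by (auto simp: closure_sequential)
  then show "scaleC c x \<in> closure S"
    using csubspace_scaleC[OF assms] bounded_linear.tendsto[OF bounded_linear_scaleC]
    by (auto simp: closure_sequential intro!: exI[of _ "\<lambda>n. scaleC c (f n)"])
qed

lemma csubspace_min_distance_attained:
  fixes S :: "'a::chilbert set"
  assumes S: "csubspace S" "closed S"
  shows "\<exists>p\<in>S. \<forall>s\<in>S. norm (z - p) \<le> norm (z - s)"
proof -
  define d where "d = (INF s\<in>S. norm (z - s))"
  have ne: "S \<noteq> {}" using csubspace_0[OF S(1)] by auto
  have bdd: "bdd_below ((\<lambda>s. norm (z - s)) ` S)" by (rule bdd_belowI2[of _ 0]) simp
  have dle: "d \<le> norm (z - s)" if "s \<in> S" for s
    unfolding d_def by (rule cINF_lower[OF bdd that])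
  have d0: "d \<ge> 0" unfolding d_def by (rule cINF_greatest[OF ne]) simp
  have "\<exists>s\<in>S. norm (z - s) < d + 1 / real (Suc n)" for n
  proof -
    have "d < d + 1 / real (Suc n)" by simp
    then show ?thesis unfolding d_def using cINF_less_iff[OF ne bdd] by blast
  qed
  then obtain f where f: "\<And>n. f n \<in> S" "\<And>n. norm (z - f n) < d + 1 / real (Suc n)" by metis
  have lim: "(\<lambda>n. norm (z - f n)) \<longlonglongrightarrow> d"
  proof (rule tendsto_sandwich[of "\<lambda>_. d" _ _ "\<lambda>n. d + 1 / real (Suc n)"])
    show "(\<lambda>n. d + 1 / real (Suc n)) \<longlonglongrightarrow> d"
      using tendsto_add[OF tendsto_const LIMSEQ_inverse_real_of_nat] by (simp add: inverse_eq_divide)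
  qed (use dle f(1) less_imp_le[OF f(2)] in \<open>auto intro!: always_eventually\<close>)
  \<comment> \<open>The midpoint \<open>h\<close> lies in \<open>S\<close>, hence is at distance at
    least \<open>d\<close> from \<open>z\<close>. The parallelogram law converts this into closeness
    of \<open>f m\<close> and \<open>f n\<close>.\<close>
  have key: "(norm (f m - f n))\<^sup>2 \<le> 2 * (norm (z - f m))\<^sup>2 + 2 * (norm (z - f n))\<^sup>2 - 4 * d\<^sup>2" for m n
  proof -
    define h where "h = scaleR (1/2) (f m + f n)"
    have "h \<in> S" unfolding h_def by (intro csubspace_scaleR csubspace_add S f)
    then have "d\<^sup>2 \<le> (norm (z - h))\<^sup>2" using dle d0 by (simp add: power_mono)
    moreover have "(z - f m) + (z - f n) = scaleR 2 (z - h)"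
      by (simp add: h_def algebra_simps scaleR_2)
    then have "(norm ((z - f m) + (z - f n)))\<^sup>2 = 4 * (norm (z - h))\<^sup>2" by (simp add: power_mult_distrib)
    moreover have "norm ((z - f m) - (z - f n)) = norm (f m - f n)" by (simp add: norm_minus_commute)
    ultimately show ?thesis using parallelogram[of "z - f m" "z - f n"] by simp
  qed
  have "Cauchy f"
  proof (rule metric_CauchyI)
    fix e :: real assume e: "e > 0"
    have "(\<lambda>n. (norm (z - f n))\<^sup>2) \<longlonglongrightarrow> d\<^sup>2" by (intro tendsto_intros lim)
    then have "eventually (\<lambda>n. (norm (z - f n))\<^sup>2 < d\<^sup>2 + e\<^sup>2 / 4) sequentially"
      by (rule order_tendstoD) (use e in simp)
    then obtain N where N: "\<And>n. n \<ge> N \<Longrightarrow> (norm (z - f n))\<^sup>2 < d\<^sup>2 + e\<^sup>2 / 4"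
      by (auto simp: eventually_sequentially)
    have "dist (f m) (f n) < e" if "m \<ge> N" "n \<ge> N" for m n
    proof -
      have "(norm (f m - f n))\<^sup>2 < e\<^sup>2" using key[of m n] N[OF that(1)] N[OF that(2)] by simp
      then show ?thesis using e by (simp add: dist_norm power_less_imp_less_base)
    qed
    then show "\<exists>N. \<forall>m\<ge>N. \<forall>n\<ge>N. dist (f m) (f n) < e" by blast
  qed
  then obtain p where p: "f \<longlonglongrightarrow> p" using Cauchy_convergent unfolding convergent_def by blast
  have "p \<in> S" using closed_sequentially[OF S(2)] f(1) p by blast
  moreover have "norm (z - p) = d"
    by (rule LIMSEQ_unique[OF _ lim]) (intro tendsto_intros p)
  ultimately show ?thesis using dle by auto
qed

lemma csubspace_orthogonal_decomposition:
  fixes S :: "'a::chilbert set"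
  assumes S: "csubspace S" "closed S"
  shows "\<exists>p\<in>S. \<forall>s\<in>S. cinner (z - p) s = 0"
proof -
  obtain p where p: "p \<in> S" "\<And>s. s \<in> S \<Longrightarrow> norm (z - p) \<le> norm (z - s)"
    using csubspace_min_distance_attained[OF S] by blast
  have "cinner (z - p) s = 0" if s: "s \<in> S" for s
  proof (cases "s = 0")
    case False
    define w where "w = z - p"
    \<comment> \<open>Moving \<open>p\<close> by \<open>scaleC a s\<close> lowers the squared
      distance to \<open>z\<close> by |<w, s>|^2 / |s|^2, the largest gain along this line.
      Minimality of \<open>p\<close> forces the gain to vanish.\<close>
    define a where "a = cinner w s / complex_of_real ((norm s)\<^sup>2)"
    have ns: "norm s > 0" using False by simp
    have a: "a * complex_of_real ((norm s)\<^sup>2) = cinner w s" using False by (simp add: a_def)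
    have "p + scaleC a s \<in> S" by (intro csubspace_add csubspace_scaleC S p s)
    from p(2)[OF this] have "norm w \<le> norm (w - scaleC a s)" by (simp add: w_def algebra_simps)
    then have "(norm w)\<^sup>2 \<le> (norm (w - scaleC a s))\<^sup>2" by (simp add: power_mono)
    also have "\<dots> = Re (cinner w w - cnj a * cinner w s - a * cinner s w + a * cnj a * cinner s s)"
      unfolding norm_sq
      by (simp add: cinner_diff_left cinner_diff_right cinner_scaleC_left cinner_scaleC_right algebra_simps)
    also have "cinner w w - cnj a * cinner w s - a * cinner s w + a * cnj a * cinner s s
        = cinner w w - a * cinner s w"
      using a by (simp add: cinner_self[of s] algebra_simps)
    also have "\<dots> = complex_of_real ((norm w)\<^sup>2 - (cmod (cinner w s))\<^sup>2 / (norm s)\<^sup>2)"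
      by (simp add: a_def cinner_commute[of s w] cinner_self[of w] complex_norm_square[symmetric])
    finally have "(cmod (cinner w s))\<^sup>2 / (norm s)\<^sup>2 \<le> 0" by simp
    then show ?thesis using ns by (simp add: w_def divide_le_0_iff)
  qed simp
  then show ?thesis using p(1) by blast
qed

text \<open>Orthogonality of the remainder, rather than minimality of the distance, is the defining
  property: linearity and commutation with operators then reduce to uniqueness.\<close>

definition oproj :: "'a::chilbert set \<Rightarrow> 'a \<Rightarrow> 'a" where
  "oproj S z = (SOME p. p \<in> S \<and> (\<forall>s\<in>S. cinner (z - p) s = 0))"

lemma oproj:
  assumes "csubspace S" "closed S"
  shows oproj_in: "oproj S z \<in> S" and oproj_orthogonal: "s \<in> S \<Longrightarrow> cinner (z - oproj S z) s = 0"
proof -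
  have "oproj S z \<in> S \<and> (\<forall>s\<in>S. cinner (z - oproj S z) s = 0)"
    unfolding oproj_def by (rule someI_ex) (use csubspace_orthogonal_decomposition[OF assms] in blast)
  then show "oproj S z \<in> S" "s \<in> S \<Longrightarrow> cinner (z - oproj S z) s = 0" by auto
qed

lemma oproj_unique:
  assumes S: "csubspace S" "closed S" and p: "p \<in> S" "\<And>s. s \<in> S \<Longrightarrow> cinner (z - p) s = 0"
  shows "oproj S z = p"
proof -
  define q where "q = oproj S z - p"
  have q: "q \<in> S" unfolding q_def by (intro csubspace_diff oproj S p)
  have "cinner q q = cinner (z - p) q - cinner (z - oproj S z) q"
    by (simp add: q_def cinner_diff_left)
  also have "\<dots> = 0" using p(2)[OF q] oproj_orthogonal[OF S q] by simp
  finally show ?thesis by (simp add: cinner_self_eq_0 q_def)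
qed

lemma oproj_id: "csubspace S \<Longrightarrow> closed S \<Longrightarrow> p \<in> S \<Longrightarrow> oproj S p = p"
  by (rule oproj_unique) auto

section \<open>Bounded operators\<close>

lemma bop_add: "bop K A \<Longrightarrow> x \<in> K \<Longrightarrow> y \<in> K \<Longrightarrow> A (x + y) = A x + A y"
  and bop_scaleC: "bop K A \<Longrightarrow> x \<in> K \<Longrightarrow> A (scaleC c x) = scaleC c (A x)"
  and bop_in: "bop K A \<Longrightarrow> x \<in> K \<Longrightarrow> A x \<in> K"
  by (auto simp: bop_def clinear_on_def)

lemma bop_bound:
  assumes "bop K A" obtains c where "c > 0" "\<And>x. x \<in> K \<Longrightarrow> norm (A x) \<le> c * norm x"
proof -
  from assms obtain c where c: "\<forall>x\<in>K. norm (A x) \<le> c * norm x" unfolding bop_def by blast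
  have "norm (A x) \<le> (\<bar>c\<bar> + 1) * norm x" if "x \<in> K" for x
    using c that by (smt (verit) mult_right_mono norm_ge_zero)
  then show thesis using that[of "\<bar>c\<bar> + 1"] by auto
qed

lemma bop_UNIV_I:
  assumes "\<And>x y. A (x + y) = A x + A y" "\<And>c x. A (scaleC c x) = scaleC c (A x)"
    "\<And>x. norm (A x) \<le> b * norm x"
  shows "bop UNIV A"
  using assms unfolding bop_def ext_on_def clinear_on_def by blast

lemma bop_UNIV_bounded_linear:
  assumes "bop UNIV A" shows "bounded_linear A"
proof -
  obtain c where "\<And>x. norm (A x) \<le> c * norm x" using bop_bound[OF assms] by auto
  then show ?thesis
    using bop_add[OF assms] bop_scaleC[OF assms]
    by (intro bounded_linear_intro[of _ c]) (auto simp: scaleC_of_real[symmetric] mult.commute)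
qed

lemma bop_UNIV_tendsto: "bop UNIV A \<Longrightarrow> (f \<longlongrightarrow> x) F \<Longrightarrow> ((\<lambda>y. A (f y)) \<longlongrightarrow> A x) F"
  by (rule bounded_linear.tendsto[OF bop_UNIV_bounded_linear])

lemma bop_UNIV_continuous: "bop UNIV A \<Longrightarrow> continuous_on S A"
  by (rule linear_continuous_on[OF bop_UNIV_bounded_linear])

lemma bop_UNIV_zero: "bop UNIV A \<Longrightarrow> A 0 = 0"
  and bop_UNIV_diff: "bop UNIV A \<Longrightarrow> A (x - y) = A x - A y"
  using linear_0[of A] linear_diff[of A] bounded_linear.linear[OF bop_UNIV_bounded_linear[of A]] by blast+

lemma bop_UNIV_comp:
  assumes "bop UNIV A" "bop UNIV B" shows "bop UNIV (\<lambda>x. A (B x))"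
proof -
  obtain a where a: "a > 0" "\<And>x. norm (A x) \<le> a * norm x" using bop_bound[OF assms(1)] by auto
  obtain b where b: "\<And>x. norm (B x) \<le> b * norm x" using bop_bound[OF assms(2)] by auto
  have "norm (A (B x)) \<le> (a * b) * norm x" for x
    using order_trans[OF a(2)[of "B x"] mult_left_mono[OF b[of x], of a]] a(1) by (simp add: mult.assoc)
  then show ?thesis
    by (intro bop_UNIV_I) (simp_all add: bop_add[OF assms(1)] bop_add[OF assms(2)]
      bop_scaleC[OF assms(1)] bop_scaleC[OF assms(2)])
qed

lemma bop_UNIV_id: "bop UNIV (\<lambda>x::'a::chilbert. x)"
  by (rule bop_UNIV_I[of _ 1]) auto

lemma bop_oproj:
  assumes S: "csubspace S" "closed S"
  shows "bop UNIV (oproj S)"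
proof (rule bop_UNIV_I[of _ 1])
  fix x y :: 'a and c
  show "oproj S (x + y) = oproj S x + oproj S y"
  proof (rule oproj_unique[OF S])
    fix s assume s: "s \<in> S"
    have "x + y - (oproj S x + oproj S y) = (x - oproj S x) + (y - oproj S y)" by simp
    then show "cinner (x + y - (oproj S x + oproj S y)) s = 0"
      using oproj_orthogonal[OF S s] by (simp only: cinner_add_left) simp
  qed (intro csubspace_add oproj S)
  show "oproj S (scaleC c x) = scaleC c (oproj S x)"
    by (rule oproj_unique[OF S])
      (simp_all add: csubspace_scaleC oproj S scaleC_diff_right[symmetric] cinner_scaleC_left)
  have "(norm x)\<^sup>2 = (norm (oproj S x))\<^sup>2 + (norm (x - oproj S x))\<^sup>2"
  proof -
    have "cinner (x - oproj S x) (oproj S x) = 0" by (intro oproj S)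
    moreover from this have "cinner (oproj S x) (x - oproj S x) = 0" by (subst cinner_commute) simp
    moreover have "cinner x x = cinner (oproj S x + (x - oproj S x)) (oproj S x + (x - oproj S x))"
      by simp
    ultimately show ?thesis unfolding norm_sq by (simp only: cinner_add_left cinner_add_right) simp
  qed
  then have "(norm (oproj S x))\<^sup>2 \<le> (norm x)\<^sup>2" by simp
  then show "norm (oproj S x) \<le> 1 * norm x" by (metis mult_1 norm_ge_zero power2_le_imp_le)
qed

text \<open>The difference is a limit of vectors orthogonal to it. Asking only that the difference
  be approximable from \<open>S\<close> covers \<open>D\<close> dense in the whole space, E D dense
  in \<open>range E\<close>, and a subspace tested against itself.\<close>

lemma cinner_eq_on_dense:
  assumes "\<And>s. s \<in> S \<Longrightarrow> cinner x s = cinner y s" "x - y \<in> closure S"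
  shows "x = (y::'a::chilbert)"
proof -
  obtain f where f: "\<And>n. f n \<in> S" "f \<longlonglongrightarrow> x - y" using assms(2) by (auto simp: closure_sequential)
  have "(\<lambda>n. cinner (x - y) (f n)) \<longlonglongrightarrow> cinner (x - y) (x - y)"
    by (intro tendsto_cinner tendsto_const f)
  moreover have "cinner (x - y) (f n) = 0" for n using assms(1)[OF f(1)] by (simp add: cinner_diff_left)
  ultimately have "cinner (x - y) (x - y) = 0" by (simp add: LIMSEQ_const_iff)
  then show ?thesis by (simp add: cinner_self_eq_0)
qed

lemma cinner_eqI: "(\<And>s. cinner x s = cinner y s) \<Longrightarrow> x = (y::'a::chilbert)"
  by (rule cinner_eq_on_dense[of UNIV]) auto

lemma cinner_eqI': "(\<And>s. cinner s x = cinner s y) \<Longrightarrow> x = (y::'a::chilbert)"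
  by (rule cinner_eqI) (metis cinner_commute)

section \<open>Riesz representation and adjoints\<close>

lemma riesz:
  fixes f :: "'a::chilbert \<Rightarrow> complex"
  assumes add: "\<And>x y. f (x + y) = f x + f y" and scl: "\<And>c x. f (scaleC c x) = c * f x"
    and bd: "\<And>x. cmod (f x) \<le> b * norm x"
  shows "\<exists>z. \<forall>x. f x = cinner x z"
proof (cases "\<forall>x. f x = 0")
  case True then show ?thesis by (intro exI[of _ 0]) simp
next
  case False
  then obtain u where u: "f u \<noteq> 0" by blast
  have bl: "bounded_linear f"
    by (rule bounded_linear_intro[of _ b])
      (use add scl bd in \<open>auto simp: scaleC_of_real[symmetric] mult.commute scaleR_conv_of_real\<close>)
  define N where "N = {x. f x = 0}"
  have f0: "f 0 = 0" using scl[of 0 0] by simp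
  have N: "csubspace N" using add scl f0 by (auto simp: N_def csubspace_def)
  have cN: "closed N" unfolding N_def
    by (intro closed_Collect_eq linear_continuous_on bl continuous_intros)
  define w where "w = u - oproj N u"
  have fd: "f (x - y) = f x - f y" for x y using bl by (rule linear_simps)
  have "f (oproj N u) = 0" using oproj_in[OF N cN, of u] by (simp add: N_def)
  then have fw: "f w \<noteq> 0" using u by (simp add: w_def fd)
  then have w0: "norm w \<noteq> 0" using f0 by auto
  have wort: "cinner w s = 0" if "f s = 0" for s
    unfolding w_def by (rule oproj_orthogonal[OF N cN]) (use that in \<open>simp add: N_def\<close>)
  \<comment> \<open>\<open>w\<close> spans the complement of the kernel of \<open>f\<close>, so
    \<open>z\<close> must be a multiple of it. The factor is fixed by the value at \<open>w\<close>,
    and is conjugated because \<open>cinner\<close> is conjugate-linear in the second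
    argument.\<close>
  define z where "z = scaleC (cnj (f w) / complex_of_real ((norm w)\<^sup>2)) w"
  have "f x = cinner x z" for x
  proof -
    have "f (x - scaleC (f x / f w) w) = 0" using fw by (simp add: fd scl)
    from wort[OF this] have "cinner (x - scaleC (f x / f w) w) w = 0" by (subst cinner_commute) simp
    then have "cinner x w = f x / f w * complex_of_real ((norm w)\<^sup>2)"
      by (simp add: cinner_diff_left cinner_scaleC_left cinner_self)
    then show ?thesis using fw w0 by (simp add: z_def cinner_scaleC_right)
  qed
  then show ?thesis by blast
qed

text \<open>Makes the definite description in \<open>badj\<close> usable: Riesz gives existence,
  nondegeneracy of the inner product gives uniqueness.\<close>

lemma cinner_badj:
  fixes A :: "'a::chilbert \<Rightarrow> 'a"
  assumes A: "bop UNIV A"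
  shows "cinner (A x) y = cinner x (badj UNIV A y)"
proof -
  obtain b where b: "b > 0" "\<And>x. norm (A x) \<le> b * norm x" using bop_bound[OF A] by auto
  have "\<exists>z. \<forall>x. cinner (A x) y = cinner x z"
  proof (rule riesz[of _ "b * norm y"])
    fix x
    have "cmod (cinner (A x) y) \<le> norm (A x) * norm y" by (rule cinner_Cauchy_Schwarz)
    also have "\<dots> \<le> (b * norm x) * norm y" by (intro mult_right_mono b) simp
    finally show "cmod (cinner (A x) y) \<le> b * norm y * norm x" by (simp add: mult_ac)
  qed (simp_all add: bop_add[OF A] bop_scaleC[OF A] cinner_add_left cinner_scaleC_left)
  then obtain z where z: "\<forall>x. cinner (A x) y = cinner x z" by blast
  have "badj UNIV A y = (THE z. \<forall>x. cinner (A x) y = cinner x z)" by (simp add: badj_def)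
  also have "\<dots> = z"
  proof (rule the_equality, rule z)
    show "z' = z" if "\<forall>x. cinner (A x) y = cinner x z'" for z'
      by (rule cinner_eqI') (metis that z)
  qed
  finally show ?thesis using z by metis
qed

lemma cinner_badj': "bop UNIV A \<Longrightarrow> cinner (badj UNIV A x) y = cinner x (A y)"
  for A :: "'a::chilbert \<Rightarrow> 'a"
  using cinner_badj[of A y x] by (metis cinner_commute)

text \<open>From |A* x|^2 = <A A* x, x>. That the constant \<open>b\<close> is preserved matters
  later, where the growth of powers of C* C is compared with powers of c^2.\<close>

lemma norm_badj_le:
  fixes A :: "'a::chilbert \<Rightarrow> 'a"
  assumes A: "bop UNIV A" and b: "\<And>x. norm (A x) \<le> b * norm x" "b \<ge> 0"
  shows "norm (badj UNIV A x) \<le> b * norm x"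
proof -
  let ?n = "norm (badj UNIV A x)"
  have "?n * ?n = cmod (cinner (badj UNIV A x) (badj UNIV A x))"
    by (simp add: cinner_self power2_eq_square norm_mult)
  also have "\<dots> = cmod (cinner (A (badj UNIV A x)) x)" by (simp add: cinner_badj[OF A])
  also have "\<dots> \<le> norm (A (badj UNIV A x)) * norm x" by (rule cinner_Cauchy_Schwarz)
  also have "\<dots> \<le> (b * ?n) * norm x" by (intro mult_right_mono b) simp
  finally have "?n * ?n \<le> ?n * (b * norm x)" by (simp add: mult_ac)
  then show "?n \<le> b * norm x" using b(2) by (cases "?n = 0") (auto simp: mult_le_cancel_left)
qed

lemma bop_badj:
  fixes A :: "'a::chilbert \<Rightarrow> 'a"
  assumes A: "bop UNIV A"
  shows "bop UNIV (badj UNIV A)"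
proof -
  obtain b where b: "b > 0" "\<And>x. norm (A x) \<le> b * norm x" using bop_bound[OF A] by auto
  show ?thesis
  proof (rule bop_UNIV_I[of _ b])
    fix x y :: 'a and c
    show "badj UNIV A (x + y) = badj UNIV A x + badj UNIV A y"
      by (rule cinner_eqI') (simp add: cinner_add_right cinner_badj[OF A, symmetric])
    show "badj UNIV A (scaleC c x) = scaleC c (badj UNIV A x)"
      by (rule cinner_eqI') (simp add: cinner_scaleC_right cinner_badj[OF A, symmetric])
    show "norm (badj UNIV A x) \<le> b * norm x" using norm_badj_le[OF A b(2)] b(1) by simp
  qed
qed

text \<open>Graphs of operators are subspaces of the direct sum. With this instance the projection
  theorem applies to their closures; the norm already present on pairs is the one induced by the
  inner product.\<close>

instantiation prod :: (chilbert, chilbert) chilbert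
begin

definition "scaleC c x = (scaleC c (fst x), scaleC c (snd x))"
definition "cinner x y = cinner (fst x) (fst y) + cinner (snd x) (snd y)"

instance
proof
  fix r a b c and x y z :: "'a \<times> 'b"
  show "scaleC (complex_of_real r) x = scaleR r x"
    by (simp add: scaleC_prod_def scaleC_of_real scaleR_prod_def)
  show "scaleC a (x + y) = scaleC a x + scaleC a y"
    by (simp add: scaleC_prod_def scaleC_add_right)
  show "scaleC (a + b) x = scaleC a x + scaleC b x"
    by (simp add: scaleC_prod_def scaleC_add_left)
  show "scaleC a (scaleC b x) = scaleC (a * b) x" by (simp add: scaleC_prod_def scaleC_scaleC)
  show "scaleC 1 x = x" by (simp add: scaleC_prod_def scaleC_one)
  show "cinner x y = cnj (cinner y x)" unfolding cinner_prod_def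
    by (metis cinner_commute complex_cnj_add)
  show "cinner (x + y) z = cinner x z + cinner y z" by (simp add: cinner_prod_def cinner_add_left)
  show "cinner (scaleC c x) y = c * cinner x y"
    by (simp add: cinner_prod_def scaleC_prod_def cinner_scaleC_left algebra_simps)
  have eq: "cinner x x = complex_of_real ((norm (fst x))\<^sup>2 + (norm (snd x))\<^sup>2)"
    by (simp add: cinner_prod_def cinner_self)
  show "Im (cinner x x) = 0 \<and> Re (cinner x x) \<ge> 0" by (simp add: eq)
  show "(cinner x x = 0) = (x = 0)"
    by (simp only: eq of_real_eq_0_iff sum_power2_eq_zero_iff) (simp add: prod_eq_iff)
  show "norm x = sqrt (Re (cinner x x))" by (simp add: eq norm_prod_def)
qed

end

text \<open>Extend by uniform continuity to the closure, then compose with the projection onto it.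
  Vanishing on the orthogonal complement is recorded because it settles commutation there when an
  induced operator is built.\<close>

lemma clinear_bounded_extension:
  fixes S :: "'a::chilbert set"
  assumes S: "csubspace S" and lin: "clinear_on S f"
    and bd: "\<And>x. x \<in> S \<Longrightarrow> norm (f x) \<le> b * norm x" and b: "b \<ge> 0"
  shows "\<exists>g. bop UNIV g \<and> (\<forall>x\<in>S. g x = f x) \<and> (\<forall>x. (\<forall>s\<in>S. cinner x s = 0) \<longrightarrow> g x = 0)"
proof -
  have fd: "f (x - y) = f x - f y" if "x \<in> S" "y \<in> S" for x y
  proof -
    have "f (x + scaleC (-1) y) = f x + scaleC (-1) (f y)"
      using lin that csubspace_scaleC[OF S] unfolding clinear_on_def by metis
    then show ?thesis by (simp add: scaleC_minus_one)
  qed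
  have "uniformly_continuous_on S f"
    unfolding uniformly_continuous_on_def
  proof (intro allI impI)
    fix e :: real assume e: "e > 0"
    \<comment> \<open>Dividing by \<open>b + 1\<close> instead of \<open>b\<close> covers
      \<open>b = 0\<close>.\<close>
    have "dist (f x') (f x) < e" if "x \<in> S" "x' \<in> S" "dist x' x < e / (b + 1)" for x x'
    proof -
      have "norm (f x' - f x) \<le> b * norm (x' - x)"
        using fd[of x' x] bd[of "x' - x"] csubspace_diff[OF S] that by simp
      also have "\<dots> \<le> (b + 1) * norm (x' - x)" by (simp add: mult_right_mono)
      also have "\<dots> < e" using that(3) b by (simp add: dist_norm field_simps)
      finally show ?thesis by (simp add: dist_norm)
    qed
    then show "\<exists>d>0. \<forall>x\<in>S. \<forall>x'\<in>S. dist x' x < d \<longrightarrow> dist (f x') (f x) < e"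
      using e b by (intro exI[of _ "e / (b + 1)"]) auto
  qed
  from uniformly_continuous_on_extension_on_closure[OF this]
  obtain g where g: "uniformly_continuous_on (closure S) g" "\<And>x. x \<in> S \<Longrightarrow> f x = g x"
    by metis
  have gc: "continuous_on (closure S) g" using g(1) by (rule uniformly_continuous_imp_continuous)
  have gl: "(\<lambda>n. f (s n)) \<longlonglongrightarrow> g x" if "\<And>n. s n \<in> S" "s \<longlonglongrightarrow> x" for s :: "nat \<Rightarrow> 'a" and x
  proof -
    have "x \<in> closure S" using that by (auto simp: closure_sequential)
    then have "(\<lambda>n. g (s n)) \<longlonglongrightarrow> g x"
      using that closure_subset by (intro continuous_on_tendsto_compose[OF gc]) (auto intro!: always_eventually)
    then show ?thesis using that g(2) by simp
  qed
  let ?S = "closure S"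
  have cS: "csubspace ?S" "closed ?S" using csubspace_closure[OF S] by auto
  have gadd: "g (x + y) = g x + g y" if xy: "x \<in> ?S" "y \<in> ?S" for x y
  proof -
    obtain s t where st: "\<And>n. s n \<in> S" "s \<longlonglongrightarrow> x" "\<And>n. t n \<in> S" "t \<longlonglongrightarrow> y"
      using xy by (metis closure_sequential)
    have "(\<lambda>n. f (s n + t n)) \<longlonglongrightarrow> g (x + y)"
      using st csubspace_add[OF S] by (intro gl tendsto_add) auto
    moreover have "(\<lambda>n. f (s n) + f (t n)) \<longlonglongrightarrow> g x + g y" using st by (intro gl tendsto_add) auto
    moreover have "f (s n + t n) = f (s n) + f (t n)" for n using lin st by (auto simp: clinear_on_def)
    ultimately show ?thesis by (simp add: LIMSEQ_unique)
  qed
  have gscl: "g (scaleC c x) = scaleC c (g x)" if x: "x \<in> ?S" for x c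
  proof -
    obtain s where st: "\<And>n. s n \<in> S" "s \<longlonglongrightarrow> x" using x by (metis closure_sequential)
    have "(\<lambda>n. f (scaleC c (s n))) \<longlonglongrightarrow> g (scaleC c x)"
      using st csubspace_scaleC[OF S] by (intro gl bounded_linear.tendsto[OF bounded_linear_scaleC]) auto
    moreover have "(\<lambda>n. scaleC c (f (s n))) \<longlonglongrightarrow> scaleC c (g x)"
      using st by (intro gl bounded_linear.tendsto[OF bounded_linear_scaleC]) auto
    moreover have "f (scaleC c (s n)) = scaleC c (f (s n))" for n using lin st by (auto simp: clinear_on_def)
    ultimately show ?thesis by (simp add: LIMSEQ_unique)
  qed
  have gbd: "norm (g x) \<le> b * norm x" if x: "x \<in> ?S" for x
  proof -
    obtain s where st: "\<And>n. s n \<in> S" "s \<longlonglongrightarrow> x" using x by (metis closure_sequential)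
    show ?thesis
      by (rule LIMSEQ_le[of "\<lambda>n. norm (f (s n))" _ "\<lambda>n. b * norm (s n)"])
        (use st bd in \<open>auto intro!: tendsto_intros gl\<close>)
  qed
  obtain p where p: "\<And>x. norm (oproj ?S x) \<le> p * norm x" using bop_bound[OF bop_oproj[OF cS]] by auto
  have P: "bop UNIV (oproj ?S)" by (rule bop_oproj[OF cS])
  let ?g = "\<lambda>x. g (oproj ?S x)"
  have "bop UNIV ?g"
  proof (rule bop_UNIV_I[of _ "b * p"])
    fix x y :: 'a and c
    show "?g (x + y) = ?g x + ?g y" using gadd oproj_in[OF cS] by (simp add: bop_add[OF P])
    show "?g (scaleC c x) = scaleC c (?g x)" using gscl oproj_in[OF cS] by (simp add: bop_scaleC[OF P])
    show "norm (?g x) \<le> b * p * norm x"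
      using gbd[OF oproj_in[OF cS]] mult_left_mono[OF p b] by (smt (verit) mult.assoc)
  qed
  moreover have "?g x = f x" if "x \<in> S" for x
    using that closure_subset[of S] oproj_id[OF cS] g(2) by auto
  moreover have "?g x = 0" if x: "\<forall>s\<in>S. cinner x s = 0" for x
  proof -
    have "cinner x s = 0" if sS: "s \<in> ?S" for s
    proof -
      obtain t where t: "\<And>n. t n \<in> S" "t \<longlonglongrightarrow> s"
        using sS by (auto simp: closure_sequential)
      have "(\<lambda>n. cinner x (t n)) \<longlonglongrightarrow> cinner x s" by (intro tendsto_cinner tendsto_const t)
      then show ?thesis using x t by (simp add: LIMSEQ_const_iff)
    qed
    then have "oproj ?S x = 0" using csubspace_0[OF cS(1)] by (intro oproj_unique[OF cS]) auto
    then show ?thesis using gscl[of 0 0] csubspace_0[OF cS(1)] by simp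
  qed
  ultimately show ?thesis by blast
qed

section \<open>Commutants\<close>

lemma bcomm_bop: "A \<in> bcomm K S \<Longrightarrow> bop K A"
  and bcomm_commute: "A \<in> bcomm K S \<Longrightarrow> C \<in> S \<Longrightarrow> x \<in> K \<Longrightarrow> A (C x) = C (A x)"
  by (auto simp: bcomm_def)

lemma bcomm_id: "(\<lambda>x. x) \<in> bcomm UNIV S"
  by (simp add: bcomm_def bop_UNIV_id)

lemma bcomm_comp: "A \<in> bcomm UNIV S \<Longrightarrow> B \<in> bcomm UNIV S \<Longrightarrow> (\<lambda>x. A (B x)) \<in> bcomm UNIV S"
  by (simp add: bcomm_def bop_UNIV_comp)

lemma bcomm_badj:
  fixes S :: "('a::chilbert \<Rightarrow> 'a) set"
  assumes S: "\<And>C. C \<in> S \<Longrightarrow> bop UNIV C" "\<And>C. C \<in> S \<Longrightarrow> badj UNIV C \<in> S"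
    and A: "A \<in> bcomm UNIV S"
  shows "badj UNIV A \<in> bcomm UNIV S"
proof -
  have bA: "bop UNIV A" using A by (rule bcomm_bop)
  have "badj UNIV A (C x) = C (badj UNIV A x)" if C: "C \<in> S" for C x
  proof (rule cinner_eqI)
    fix y
    have "cinner (badj UNIV A (C x)) y = cinner x (badj UNIV C (A y))"
      by (simp add: cinner_badj'[OF bA] cinner_badj[OF S(1)[OF C]])
    also have "\<dots> = cinner x (A (badj UNIV C y))"
      using bcomm_commute[OF A S(2)[OF C]] by simp
    also have "\<dots> = cinner (C (badj UNIV A x)) y"
      by (simp add: cinner_badj'[OF bA] cinner_badj[OF S(1)[OF C]])
    finally show "cinner (badj UNIV A (C x)) y = cinner (C (badj UNIV A x)) y" .
  qed
  then show ?thesis by (simp add: bcomm_def bop_badj[OF bA])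
qed

text \<open>The matrix entries of the orthogonal projection onto the closed graph of \<open>X\<close> lie in the
  commutant of \<open>S\<close>, so an operator in the bicommutant leaves that graph invariant.\<close>
lemma bicommutant_preserves_closed_graph:
  fixes S :: "('a::chilbert \<Rightarrow> 'a) set"
  assumes S: "\<And>C. C \<in> S \<Longrightarrow> bop UNIV C" "\<And>C. C \<in> S \<Longrightarrow> badj UNIV C \<in> S"
    and D: "csubspace D" and X: "clinear_on D X"
    and SX: "\<And>C \<xi>. C \<in> S \<Longrightarrow> \<xi> \<in> D \<Longrightarrow> C \<xi> \<in> D \<and> C (X \<xi>) = X (C \<xi>)"
    and T: "T \<in> bcomm UNIV (bcomm UNIV S)" and \<xi>: "\<xi> \<in> D"
  shows "(T \<xi>, T (X \<xi>)) \<in> closure ((\<lambda>\<zeta>. (\<zeta>, X \<zeta>)) ` D)"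
proof -
  let ?gr = "(\<lambda>\<zeta>. (\<zeta>, X \<zeta>)) ` D"
  let ?G = "closure ?gr"
  have X0: "X 0 = 0" using X csubspace_0[OF D] scaleC_zero_left unfolding clinear_on_def by metis
  have "csubspace ?gr"
    unfolding csubspace_def
  proof (intro conjI ballI allI)
    show "0 \<in> ?gr" using csubspace_0[OF D] X0 by (force simp: zero_prod_def)
  next
    fix x y assume "x \<in> ?gr" "y \<in> ?gr"
    then obtain a b where "a \<in> D" "b \<in> D" "x = (a, X a)" "y = (b, X b)" by auto
    then show "x + y \<in> ?gr"
      using X csubspace_add[OF D] by (auto simp: clinear_on_def intro!: image_eqI[of _ _ "a + b"])
  next
    fix c x assume "x \<in> ?gr"
    then obtain a where "a \<in> D" "x = (a, X a)" by auto
    then show "scaleC c x \<in> ?gr"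
      using X csubspace_scaleC[OF D]
      by (auto simp: clinear_on_def scaleC_prod_def intro!: image_eqI[of _ _ "scaleC c a"])
  qed
  then have G: "csubspace ?G" "closed ?G" using csubspace_closure by auto
  have P: "bop UNIV (oproj ?G)" by (rule bop_oproj[OF G])
  have inv: "(C (fst z), C (snd z)) \<in> ?G" if C: "C \<in> S" and z: "z \<in> ?G" for C z
  proof -
    have cont: "continuous_on UNIV (\<lambda>z. (C (fst z), C (snd z)))"
      by (intro continuous_on_Pair continuous_on_compose2[OF bop_UNIV_continuous[OF S(1)[OF C]]]
          continuous_intros) auto
    have "(\<lambda>z. (C (fst z), C (snd z))) ` ?G \<subseteq> ?G"
      by (rule image_closure_subset[OF continuous_on_subset[OF cont]])
        (use SX[OF C] closure_subset[of ?gr] in auto)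
    then show ?thesis using z by auto
  qed
  \<comment> \<open>Both the diagonal operator of \<open>C\<close> and its adjoint, the diagonal
    operator of \<open>badj UNIV C\<close>, leave \<open>?G\<close> invariant. So \<open>?G\<close>
    is a reducing subspace and its projection commutes with them.\<close>
  have PC: "oproj ?G (C x, C y) = (C (fst (oproj ?G (x, y))), C (snd (oproj ?G (x, y))))"
    if C: "C \<in> S" for C x y
  proof (rule oproj_unique[OF G])
    show "(C (fst (oproj ?G (x, y))), C (snd (oproj ?G (x, y)))) \<in> ?G"
      by (rule inv[OF C oproj_in[OF G]])
    fix s assume s: "s \<in> ?G"
    let ?p = "oproj ?G (x, y)" and ?C = "badj UNIV C"
    note bC = S(1)[OF C]
    have "cinner ((C x, C y) - (C (fst ?p), C (snd ?p))) s
        = cinner ((x, y) - ?p) (?C (fst s), ?C (snd s))"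
      by (simp add: cinner_prod_def bop_UNIV_diff[OF bC, symmetric] cinner_badj[OF bC])
    also have "\<dots> = 0" by (rule oproj_orthogonal[OF G inv[OF S(2)[OF C] s]])
    finally show "cinner ((C x, C y) - (C (fst ?p), C (snd ?p))) s = 0" .
  qed
  obtain b where b: "\<And>z. norm (oproj ?G z) \<le> b * norm z" using bop_bound[OF P] by (metis UNIV_I)
  \<comment> \<open>\<open>i\<close> ranges over the two inclusions and \<open>pr\<close> over the
    two coordinates, so the four matrix entries are treated at once.\<close>
  have entry: "(\<lambda>x. pr (oproj ?G (i x))) \<in> bcomm UNIV S"
    if pr: "pr = fst \<or> pr = snd" and i: "i = (\<lambda>x. (x, 0)) \<or> i = (\<lambda>x. (0, x))"
    for pr :: "'a \<times> 'a \<Rightarrow> 'a" and i :: "'a \<Rightarrow> 'a \<times> 'a"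
  proof -
    have "bop UNIV (\<lambda>x. pr (oproj ?G (i x)))"
    proof (rule bop_UNIV_I[of _ b])
      fix x y :: 'a and c
      have "i (x + y) = i x + i y" "i (scaleC c x) = scaleC c (i x)"
        using i by (auto simp: scaleC_prod_def)
      then show "pr (oproj ?G (i (x + y))) = pr (oproj ?G (i x)) + pr (oproj ?G (i y))"
        "pr (oproj ?G (i (scaleC c x))) = scaleC c (pr (oproj ?G (i x)))"
        using pr bop_add[OF P] bop_scaleC[OF P] by (auto simp: scaleC_prod_def)
      have "norm (pr (oproj ?G (i x))) \<le> norm (oproj ?G (i x))"
        using pr by (cases "oproj ?G (i x)") (auto simp: norm_fst_le norm_snd_le)
      also have "\<dots> \<le> b * norm (i x)" by (rule b)
      also have "norm (i x) = norm x" using i by (auto simp: norm_Pair)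
      finally show "norm (pr (oproj ?G (i x))) \<le> b * norm x" .
    qed
    moreover have "pr (oproj ?G (i (C x))) = C (pr (oproj ?G (i x)))" if C: "C \<in> S" for C x
      using pr i PC[OF C, of x 0] PC[OF C, of 0 x] bop_UNIV_zero[OF S(1)[OF C]] by auto
    ultimately show ?thesis by (simp add: bcomm_def)
  qed
  have bT: "bop UNIV T" using T by (rule bcomm_bop)
  have PT: "pr (oproj ?G (T x, T y)) = T (pr (oproj ?G (x, y)))"
    if pr: "pr = fst \<or> pr = snd" for pr :: "'a \<times> 'a \<Rightarrow> 'a" and x y
  proof -
    have split: "pr (oproj ?G (u, w)) = pr (oproj ?G (u, 0)) + pr (oproj ?G (0, w))" for u w
      using pr bop_add[OF P, of "(u, 0)" "(0, w)"] by auto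
    have "pr (oproj ?G (T x, 0)) = T (pr (oproj ?G (x, 0)))"
      "pr (oproj ?G (0, T y)) = T (pr (oproj ?G (0, y)))"
      using bcomm_commute[OF T entry[OF pr], of "\<lambda>x. (x, 0)" x]
        bcomm_commute[OF T entry[OF pr], of "\<lambda>x. (0, x)" y] by auto
    then show ?thesis using split[of "T x" "T y"] split[of x y] bop_add[OF bT] by simp
  qed
  \<comment> \<open>A point of the graph is fixed by the projection, and by \<open>PT\<close> so is
    its image under the diagonal operator of \<open>T\<close>; being fixed means lying in
    \<open>?G\<close>.\<close>
  have "(\<xi>, X \<xi>) \<in> ?G" using subsetD[OF closure_subset imageI[OF \<xi>, of "\<lambda>\<zeta>. (\<zeta>, X \<zeta>)"]] .
  then have "oproj ?G (\<xi>, X \<xi>) = (\<xi>, X \<xi>)" by (rule oproj_id[OF G])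
  then have "oproj ?G (T \<xi>, T (X \<xi>)) = (T \<xi>, T (X \<xi>))"
    using PT[of fst \<xi> "X \<xi>"] PT[of snd \<xi> "X \<xi>"] by (simp add: prod_eq_iff)
  then show ?thesis using oproj_in[OF G] by metis
qed

section \<open>The commutant of a reduced algebra\<close>

lemma doubling_sequence_le:
  fixes r :: "nat \<Rightarrow> real"
  assumes pos: "\<And>k. r k \<ge> 0" "n \<ge> 0" "b > 0"
    and step: "\<And>k. (r k)\<^sup>2 \<le> r (Suc k) * n" and bd: "\<And>k. r k \<le> K * b ^ 2 ^ k"
  shows "r 0 \<le> b * n"
proof (cases "n = 0")
  case True then show ?thesis using step[of 0] pos(1)[of 0] by simp
next
  case False
  then have n: "n > 0" using pos by simp
  \<comment> \<open>The normalisation turns the hypotheses into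
    \<open>(s k)\<^sup>2 \<le> s (Suc k)\<close> and the uniform bound \<open>K / n\<close>. All
    powers of \<open>s 0\<close> with exponent 2^k are then bounded, which forces
    \<open>s 0 \<le> 1\<close> whatever \<open>K\<close> is.\<close>
  define s where "s k = r k / (n * b ^ 2 ^ k)" for k
  have s0: "s k \<ge> 0" for k using pos n by (simp add: s_def)
  have ss: "(s k)\<^sup>2 \<le> s (Suc k)" for k
  proof -
    have "b ^ 2 ^ Suc k = (b ^ 2 ^ k)\<^sup>2" by (simp add: power_mult[symmetric] mult.commute)
    then have "s (Suc k) = r (Suc k) * n / (n * b ^ 2 ^ k)\<^sup>2"
      using n by (simp add: s_def power_mult_distrib power2_eq_square)
    moreover have "(s k)\<^sup>2 = (r k)\<^sup>2 / (n * b ^ 2 ^ k)\<^sup>2" by (simp add: s_def power_divide)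
    ultimately show ?thesis using step[of k] by (simp add: divide_right_mono)
  qed
  have sp: "s 0 ^ 2 ^ k \<le> s k" for k
  proof (induction k)
    case (Suc k)
    have "s 0 ^ 2 ^ Suc k = (s 0 ^ 2 ^ k)\<^sup>2" by (simp add: power_mult[symmetric] mult.commute)
    also have "\<dots> \<le> (s k)\<^sup>2" using Suc s0 by (intro power_mono) auto
    also have "\<dots> \<le> s (Suc k)" by (rule ss)
    finally show ?case .
  qed simp
  have sb: "s k \<le> K / n" for k using bd[of k] n pos(3) by (simp add: s_def field_simps)
  have "s 0 \<le> 1"
  proof (rule ccontr)
    assume "\<not> s 0 \<le> 1"
    then have gt: "s 0 > 1" by simp
    then obtain m where "K / n < s 0 ^ m" using real_arch_pow by blast
    also have "\<dots> \<le> s 0 ^ 2 ^ m" using gt by (intro power_increasing) (auto intro: less_imp_le less_exp)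
    also have "\<dots> \<le> K / n" using sp sb order_trans by blast
    finally show False by simp
  qed
  then show ?thesis using n pos(3) by (simp add: s_def field_simps)
qed

text \<open>The list is a formal sum, and \<open>B\<close> is inserted between its operators and
  vectors, so that one list yields both \<open>\<Sum> A\<^sub>i E \<xi>\<^sub>i\<close> and
  \<open>\<Sum> A\<^sub>i C \<xi>\<^sub>i\<close>. With lists, addition of vectors is concatenation
  and repetitions cause no trouble.\<close>

definition opsum :: "(('a::chilbert \<Rightarrow> 'a) \<times> 'a) list \<Rightarrow> ('a \<Rightarrow> 'a) \<Rightarrow> 'a" where
  "opsum l B = (\<Sum>(A, \<xi>)\<leftarrow>l. A (B \<xi>))"

lemma opsum_simps [simp]:
  "opsum [] B = 0" "opsum ((A, \<xi>) # l) B = A (B \<xi>) + opsum l B"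
  "opsum (l @ l') B = opsum l B + opsum l' B"
  by (simp_all add: opsum_def)

text \<open>The scalar is put on the vectors so that the operators in the list stay the same and
  hence stay in \<open>N\<close>.\<close>

lemma opsum_scaleC:
  assumes "\<And>A \<xi>. (A, \<xi>) \<in> set l \<Longrightarrow> bop UNIV A" "bop UNIV B"
  shows "opsum (map (\<lambda>(A, \<xi>). (A, scaleC c \<xi>)) l) B = scaleC c (opsum l B)"
  using assms(1)
proof (induction l)
  case (Cons a l)
  obtain A \<xi> where a: "a = (A, \<xi>)" by force
  then have "bop UNIV A" using Cons.prems by auto
  moreover have "opsum (map (\<lambda>(A, \<xi>). (A, scaleC c \<xi>)) l) B = scaleC c (opsum l B)"
    using Cons by auto
  ultimately show ?case using assms(2) a by (simp add: bop_scaleC scaleC_add_right)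
qed simp

text \<open>The point is the order of quantifiers: \<open>K\<close> depends on the list only. It
  supplies the a priori growth bound for \<open>doubling_sequence_le\<close>, where the size of
  \<open>K\<close> is irrelevant.\<close>

lemma opsum_bounded:
  assumes "\<forall>(A, \<xi>)\<in>set l. bop UNIV A"
  shows "\<exists>K\<ge>0. \<forall>B \<beta>. \<beta> \<ge> 0 \<longrightarrow> (\<forall>x. norm (B x) \<le> \<beta> * norm x) \<longrightarrow> norm (opsum l B) \<le> K * \<beta>"
  using assms
proof (induction l)
  case (Cons a l)
  obtain A \<xi> where a: "a = (A, \<xi>)" by force
  have bA: "bop UNIV A" using Cons.prems a by auto
  obtain c where c: "c > 0" "\<And>x. norm (A x) \<le> c * norm x" using bop_bound[OF bA] by auto
  obtain K where K: "K \<ge> 0" "\<And>B \<beta>. \<beta> \<ge> 0 \<Longrightarrow> (\<forall>x. norm (B x) \<le> \<beta> * norm x) \<Longrightarrow> norm (opsum l B) \<le> K * \<beta>"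
    using Cons.IH Cons.prems by auto
  show ?case
  proof (intro exI[of _ "c * norm \<xi> + K"] conjI allI impI)
    fix B :: "'a \<Rightarrow> 'a" and \<beta> :: real assume \<beta>: "\<beta> \<ge> 0" and B: "\<forall>x. norm (B x) \<le> \<beta> * norm x"
    have "norm (opsum (a # l) B) \<le> norm (A (B \<xi>)) + norm (opsum l B)" by (simp add: a norm_triangle_ineq)
    also have "\<dots> \<le> c * (\<beta> * norm \<xi>) + K * \<beta>"
      using c(1) B by (intro add_mono K(2)[OF \<beta> B] order_trans[OF c(2)] mult_left_mono) auto
    finally show "norm (opsum (a # l) B) \<le> (c * norm \<xi> + K) * \<beta>" by (simp add: algebra_simps)
  qed (use c(1) K(1) in simp)
qed (intro exI[of _ 0], simp)

text \<open>The commutant of the reduced algebra \<open>E N E\<close> is induced by the commutant of \<open>N\<close>: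
  the extension sends \<open>\<Sum> A\<^sub>i E \<xi>\<^sub>i\<close> to \<open>\<Sum> A\<^sub>i C \<xi>\<^sub>i\<close> and vanishes on the orthogonal complement.\<close>
lemma reduced_commutant_extension:
  fixes N :: "('a::chilbert \<Rightarrow> 'a) set"
  assumes N: "\<And>A. A \<in> N \<Longrightarrow> bop UNIV A" "(\<lambda>x. x) \<in> N"
      "\<And>A B. A \<in> N \<Longrightarrow> B \<in> N \<Longrightarrow> (\<lambda>x. A (B x)) \<in> N" "\<And>A. A \<in> N \<Longrightarrow> badj UNIV A \<in> N"
    and E: "bop UNIV E" "\<And>x. E (E x) = E x" "\<And>x y. cinner (E x) y = cinner x (E y)"
    and C: "bop UNIV C" "\<And>x. E (C x) = C x" "\<And>x. C (E x) = C x"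
      "\<And>A x. A \<in> N \<Longrightarrow> C (E (A (E x))) = E (A (C x))"
  shows "\<exists>T\<in>bcomm UNIV N. \<forall>x. T (E x) = C x"
proof -
  \<comment> \<open>The commutant of E N E, realised by operators on the whole space that vanish on
    the kernel of \<open>E\<close>; \<open>E\<close> acts on them as a two-sided unit.\<close>
  define com where "com B \<longleftrightarrow> bop UNIV B \<and> (\<forall>x. E (B x) = B x) \<and> (\<forall>x. B (E x) = B x) \<and>
      (\<forall>A\<in>N. \<forall>x. B (E (A (E x))) = E (A (B x)))" for B
  have comD: "bop UNIV B" "E (B x) = B x" "B (E x) = B x"
    "A \<in> N \<Longrightarrow> B (E (A (E x))) = E (A (B x))" if "com B" for A B x
    using that unfolding com_def by blast+
  have comE: "com E" using E by (auto simp: com_def)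
  have comC: "com C" using C by (auto simp: com_def)
  have com_adj: "com (badj UNIV B)" if B: "com B" for B
  proof -
    note bB = comD(1)[OF B]
    have EB: "E (badj UNIV B x) = badj UNIV B x" for x
      by (rule cinner_eqI) (simp add: E(3) cinner_badj'[OF bB] comD(3)[OF B])
    moreover have "badj UNIV B (E x) = badj UNIV B x" for x
      by (rule cinner_eqI) (simp add: E(3) cinner_badj'[OF bB] comD(2)[OF B])
    moreover have "badj UNIV B (E (A (E x))) = E (A (badj UNIV B x))" if A: "A \<in> N" for A x
    proof (rule cinner_eqI)
      fix y
      note bA = N(1)[OF A]
      have "cinner (badj UNIV B (E (A (E x)))) y = cinner x (E (badj UNIV A (B y)))"
        by (simp add: cinner_badj'[OF bB] E(3) cinner_badj[OF bA] comD(2)[OF B])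
      also have "\<dots> = cinner x (B (E (badj UNIV A (E y))))"
        using comD(4)[OF B N(4)[OF A]] by simp
      also have "\<dots> = cinner (badj UNIV B x) (E (badj UNIV A (E y)))"
        by (rule cinner_badj'[OF bB, symmetric])
      also have "\<dots> = cinner (E (badj UNIV B x)) (badj UNIV A (E y))" by (rule E(3)[symmetric])
      also have "\<dots> = cinner (A (E (badj UNIV B x))) (E y)" by (rule cinner_badj[OF bA, symmetric])
      also have "\<dots> = cinner (E (A (badj UNIV B x))) y" by (simp only: EB E(3))
      finally show "cinner (badj UNIV B (E (A (E x)))) y = cinner (E (A (badj UNIV B x))) y" .
    qed
    ultimately show ?thesis using bop_badj[OF bB] EB by (auto simp: com_def)
  qed
  have com_comp: "com (\<lambda>x. B (B' x))" if B: "com B" and B': "com B'" for B B'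
  proof -
    have "B (B' (E (A (E x)))) = E (A (B (B' x)))" if A: "A \<in> N" for A x
    proof -
      have "B (B' (E (A (E x)))) = B (E (A (E (B' x))))"
        by (simp only: comD(4)[OF B' A] comD(2)[OF B'])
      then show ?thesis by (simp only: comD(4)[OF B A])
    qed
    then show ?thesis
      unfolding com_def using bop_UNIV_comp[OF comD(1)[OF B] comD(1)[OF B']] comD(2)[OF B] comD(3)[OF B']
      by simp
  qed
  define L :: "(('a \<Rightarrow> 'a) \<times> 'a) list set" where "L = {l. \<forall>(A, \<xi>)\<in>set l. A \<in> N}"
  have Lb: "bop UNIV A" if "l \<in> L" "(A, \<xi>) \<in> set l" for l A \<xi> using that N(1) by (auto simp: L_def)
  \<comment> \<open>Transfers \<open>B'\<close> from the right vector to the left one: its adjoint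
    commutes with the compression of A'* A, and this product is again in \<open>N\<close>.\<close>
  have single: "cinner (A (B \<xi>)) (A' (B' \<xi>')) = cinner (A (badj UNIV B' (B \<xi>))) (A' (E \<xi>'))"
    if B: "com B" and B': "com B'" and A: "A \<in> N" and A': "A' \<in> N" for A B \<xi> A' B' \<xi>'
  proof -
    note bA' = N(1)[OF A'] and bB' = comD(1)[OF B']
    have N': "(\<lambda>x. badj UNIV A' (A x)) \<in> N" by (rule N(3)[OF N(4)[OF A'] A])
    have "cinner (A (B \<xi>)) (A' (B' \<xi>')) = cinner (badj UNIV A' (A (B \<xi>))) (E (B' \<xi>'))"
      by (simp add: cinner_badj'[OF bA'] comD(2)[OF B'])
    also have "\<dots> = cinner (badj UNIV B' (E (badj UNIV A' (A (E (B \<xi>)))))) \<xi>'"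
      by (simp add: E(3) cinner_badj'[OF bB'] comD(2)[OF B] comD(2)[OF B'])
    also have "\<dots> = cinner (E (badj UNIV A' (A (badj UNIV B' (B \<xi>))))) \<xi>'"
      using comD(4)[OF com_adj[OF B'] N'] by simp
    also have "\<dots> = cinner (A (badj UNIV B' (B \<xi>))) (A' (E \<xi>'))"
      by (simp add: E(3) cinner_badj'[OF bA'])
    finally show ?thesis .
  qed
  have key1: "cinner (A (B \<xi>)) (opsum l' B') = cinner (A (badj UNIV B' (B \<xi>))) (opsum l' E)"
    if B: "com B" and B': "com B'" and A: "A \<in> N" and l': "l' \<in> L" for A B \<xi> l' B'
    using l'
  proof (induction l')
    case (Cons a l')
    obtain A' \<xi>' where a: "a = (A', \<xi>')" by force
    have "A' \<in> N" "l' \<in> L" using Cons.prems a by (auto simp: L_def)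
    then show ?case using Cons.IH single[OF B B' A] a by (simp add: cinner_add_right)
  qed simp
  have key: "cinner (opsum l B) (opsum l' B') = cinner (opsum l (\<lambda>x. badj UNIV B' (B x))) (opsum l' E)"
    if B: "com B" and B': "com B'" and l: "l \<in> L" and l': "l' \<in> L" for B l l' B'
    using l
  proof (induction l)
    case (Cons a l)
    obtain A \<xi> where a: "a = (A, \<xi>)" by force
    have "A \<in> N" "l \<in> L" using Cons.prems a by (auto simp: L_def)
    then show ?case using Cons.IH key1[OF B B' _ l'] a by (simp add: cinner_add_left)
  qed simp
  have nsq: "(norm (opsum l B))\<^sup>2 \<le> norm (opsum l (\<lambda>x. badj UNIV B (B x))) * norm (opsum l E)"
    if B: "com B" and l: "l \<in> L" for B l
  proof -
    have "(norm (opsum l B))\<^sup>2 = cmod (cinner (opsum l B) (opsum l B))"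
      by (simp add: cinner_self norm_power)
    then show ?thesis using key[OF B B l l] cinner_Cauchy_Schwarz by metis
  qed
  obtain c where c: "c > 0" "\<And>x. norm (C x) \<le> c * norm x" using bop_bound[OF C(1)] by auto
  \<comment> \<open>Instead of taking the square root of a positive matrix over \<open>E N E\<close>, \<open>\<parallel>v B\<parallel>\<^sup>2 \<le> \<parallel>v (B\<^sup>* B)\<parallel> \<parallel>v E\<parallel>\<close> is iterated
    along the powers of \<open>C\<^sup>* C\<close>, where \<open>v B = \<Sum> A\<^sub>i B \<xi>\<^sub>i\<close>.\<close>
  have bound: "norm (opsum l C) \<le> c * norm (opsum l E)" if l: "l \<in> L" for l
  proof -
    \<comment> \<open>\<open>Q k\<close> is C* C raised to the power 2^k. It is self-adjoint, so
      \<open>badj UNIV (Q k)\<close> composed with \<open>Q k\<close> is \<open>Q (Suc k)\<close>,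
      the form required by \<open>nsq\<close>.\<close>
    define Q where "Q = rec_nat (\<lambda>x. badj UNIV C (C x)) (\<lambda>_ q x. q (q x))"
    have Q0: "Q 0 = (\<lambda>x. badj UNIV C (C x))" and QS: "Q (Suc k) = (\<lambda>x. Q k (Q k x))" for k
      by (simp_all add: Q_def)
    have Qcom: "com (Q k)" for k
      by (induction k) (simp_all add: Q0 QS com_comp com_adj comC)
    have Qsym: "cinner (Q k x) y = cinner x (Q k y)" for k x y
      by (induction k arbitrary: x y) (simp_all add: Q0 QS cinner_badj'[OF C(1)] cinner_badj[OF C(1)])
    have Qadj: "badj UNIV (Q k) = Q k" for k
      by (rule ext, rule cinner_eqI) (simp add: cinner_badj'[OF comD(1)[OF Qcom]] Qsym)
    have Qb: "norm (Q k x) \<le> (c\<^sup>2) ^ 2 ^ k * norm x" for k x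
    proof (induction k arbitrary: x)
      case 0
      have "norm (badj UNIV C (C x)) \<le> c * norm (C x)"
        using norm_badj_le[OF C(1) c(2)] c(1) by simp
      also have "\<dots> \<le> c * (c * norm x)" using c by (intro mult_left_mono) auto
      finally show ?case by (simp add: Q0 power2_eq_square mult.assoc)
    next
      case (Suc k)
      have "norm (Q k (Q k x)) \<le> (c\<^sup>2) ^ 2 ^ k * norm (Q k x)" by (rule Suc)
      also have "\<dots> \<le> (c\<^sup>2) ^ 2 ^ k * ((c\<^sup>2) ^ 2 ^ k * norm x)" by (intro mult_left_mono Suc) simp
      also have "\<dots> = ((c\<^sup>2) ^ 2 ^ k)\<^sup>2 * norm x" by (simp add: power2_eq_square mult.assoc)
      also have "((c\<^sup>2) ^ 2 ^ k)\<^sup>2 = (c\<^sup>2) ^ 2 ^ Suc k" by (simp only: power_mult[symmetric] power_Suc2 mult.assoc)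
      finally show ?case by (simp only: QS)
    qed
    have "\<forall>(A, \<xi>)\<in>set l. bop UNIV A" using Lb[OF l] by auto
    then obtain K where K: "K \<ge> 0"
      "\<And>B \<beta>. \<beta> \<ge> 0 \<Longrightarrow> (\<forall>x. norm (B x) \<le> \<beta> * norm x) \<Longrightarrow> norm (opsum l B) \<le> K * \<beta>"
      using opsum_bounded[of l] by auto
    \<comment> \<open>The growth rate (c^2)^(2^k) of \<open>Q k\<close> leaves the factor c^2. One
      more use of \<open>nsq\<close>, for C itself, then gives the constant
      \<open>c\<close>.\<close>
    have "norm (opsum l (Q 0)) \<le> c\<^sup>2 * norm (opsum l E)"
    proof (rule doubling_sequence_le[of "\<lambda>k. norm (opsum l (Q k))" _ _ K])
      fix k
      show "(norm (opsum l (Q k)))\<^sup>2 \<le> norm (opsum l (Q (Suc k))) * norm (opsum l E)"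
        using nsq[OF Qcom l, of k] by (simp add: Qadj QS)
      show "norm (opsum l (Q k)) \<le> K * (c\<^sup>2) ^ 2 ^ k" by (rule K(2)) (use Qb in auto)
    qed (use c in auto)
    then have "norm (opsum l (Q 0)) * norm (opsum l E) \<le> (c\<^sup>2 * norm (opsum l E)) * norm (opsum l E)"
      by (rule mult_right_mono) simp
    then have "(norm (opsum l C))\<^sup>2 \<le> (c * norm (opsum l E))\<^sup>2"
      using nsq[OF comC l] by (simp add: Q0 power2_eq_square mult_ac)
    then show ?thesis by (rule power2_le_imp_le) (use c in simp)
  qed
  have L_app: "l @ l' \<in> L" if "l \<in> L" "l' \<in> L" for l l' using that by (auto simp: L_def)
  have L_scl: "map (\<lambda>(A, \<xi>). (A, scaleC k \<xi>)) l \<in> L" if "l \<in> L" for l k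
    using that by (force simp: L_def)
  have scl: "opsum (map (\<lambda>(A, \<xi>). (A, scaleC k \<xi>)) l) B = scaleC k (opsum l B)"
    if "l \<in> L" "com B" for l k B
    by (rule opsum_scaleC) (use Lb[OF that(1)] comD(1)[OF that(2)] in auto)
  \<comment> \<open>\<open>bound\<close> for the formal difference of the lists: the image depends
    only on the vector represented, so \<open>f\<close> may choose any representing list.\<close>
  have wd: "opsum l C = opsum l' C" if l: "l \<in> L" "l' \<in> L" and eq: "opsum l E = opsum l' E" for l l'
  proof -
    let ?l = "l @ map (\<lambda>(A, \<xi>). (A, scaleC (-1) \<xi>)) l'"
    have "norm (opsum ?l C) \<le> c * norm (opsum ?l E)" by (intro bound L_app L_scl l)
    then show ?thesis using eq
      by (simp only: opsum_simps scl[OF l(2) comC] scl[OF l(2) comE]) (simp add: scaleC_minus_one)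
  qed
  define S where "S = (\<lambda>l. opsum l E) ` L"
  define f where "f x = opsum (SOME l. l \<in> L \<and> opsum l E = x) C" for x
  have f: "f (opsum l E) = opsum l C" if l: "l \<in> L" for l
  proof -
    have "(SOME l'. l' \<in> L \<and> opsum l' E = opsum l E) \<in> L \<and>
        opsum (SOME l'. l' \<in> L \<and> opsum l' E = opsum l E) E = opsum l E"
      by (rule someI[of _ l]) (use l in simp)
    then show ?thesis unfolding f_def using wd l by blast
  qed
  have S: "csubspace S"
    unfolding csubspace_def
  proof (intro conjI ballI allI)
    show "0 \<in> S" unfolding S_def by (rule image_eqI[of _ _ "[]"]) (auto simp: L_def)
  next
    fix x y assume "x \<in> S" "y \<in> S"
    then obtain l l' where l: "l \<in> L" "l' \<in> L" "x = opsum l E" "y = opsum l' E" by (auto simp: S_def)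
    show "x + y \<in> S" unfolding S_def by (rule image_eqI[OF _ L_app[OF l(1,2)]]) (simp add: l)
  next
    fix k x assume "x \<in> S"
    then obtain l where l: "l \<in> L" "x = opsum l E" by (auto simp: S_def)
    show "scaleC k x \<in> S"
      unfolding S_def by (rule image_eqI[OF _ L_scl[OF l(1)]]) (simp add: scl[OF l(1) comE] l(2))
  qed
  have "clinear_on S f"
    unfolding clinear_on_def
  proof (intro conjI ballI allI)
    fix x y assume "x \<in> S" "y \<in> S"
    then obtain l l' where l: "l \<in> L" "l' \<in> L" "x = opsum l E" "y = opsum l' E" by (auto simp: S_def)
    then show "f (x + y) = f x + f y" using f[OF L_app[OF l(1,2)]] by (simp add: f)
  next
    fix k x assume "x \<in> S"
    then obtain l where l: "l \<in> L" "x = opsum l E" by (auto simp: S_def)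
    then show "f (scaleC k x) = scaleC k (f x)"
      using f[OF L_scl[OF l(1)]] scl[OF l(1) comE] scl[OF l(1) comC] by (simp add: f)
  qed
  moreover have "norm (f x) \<le> c * norm x" if "x \<in> S" for x
    using that bound by (auto simp: S_def f)
  ultimately obtain T where T: "bop UNIV T" "\<And>x. x \<in> S \<Longrightarrow> T x = f x"
    "\<And>x. (\<forall>s\<in>S. cinner x s = 0) \<Longrightarrow> T x = 0"
    using clinear_bounded_extension[OF S, of f c] c(1) by auto
  have actL: "\<exists>l'\<in>L. opsum l' E = A (opsum l E) \<and> opsum l' C = A (opsum l C)"
    if A: "A \<in> N" and l: "l \<in> L" for A l
  proof -
    \<comment> \<open>Left multiplication by \<open>A\<close> changes only the operators of the
      list, so the same new list serves for \<open>E\<close> and for \<open>C\<close>. This gives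
      invariance of \<open>S\<close> and commutation on it.\<close>
    let ?l = "map (\<lambda>(B, \<xi>). (\<lambda>x. A (B x), \<xi>)) l"
    have "?l \<in> L" using l N(3)[OF A] by (force simp: L_def)
    moreover have "opsum ?l B = A (opsum l B)" for B
      by (induction l) (auto simp: bop_UNIV_zero[OF N(1)[OF A]] bop_add[OF N(1)[OF A]])
    ultimately show ?thesis by blast
  qed
  have AS: "A x \<in> S" if A: "A \<in> N" and x: "x \<in> S" for A x
  proof -
    obtain l where l: "l \<in> L" "x = opsum l E" using x by (auto simp: S_def)
    obtain l' where "l' \<in> L" "opsum l' E = A x" using actL[OF A l(1)] l(2) by auto
    then show ?thesis unfolding S_def by (metis imageI)
  qed
  have TS: "T (A x) = A (T x)" if A: "A \<in> N" and x: "x \<in> S" for A x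
  proof -
    obtain l where l: "l \<in> L" "x = opsum l E" using x by (auto simp: S_def)
    obtain l' where l': "l' \<in> L" "opsum l' E = A x" "opsum l' C = A (opsum l C)"
      using actL[OF A l(1)] l(2) by auto
    have "T (A x) = opsum l' C" using T(2)[OF AS[OF A x]] f[OF l'(1)] l'(2) by simp
    also have "\<dots> = A (T x)" using T(2)[OF x] f[OF l(1)] l(2) l'(3) by simp
    finally show ?thesis .
  qed
  have cS: "csubspace (closure S)" "closed (closure S)" using csubspace_closure[OF S] by auto
  \<comment> \<open>Split \<open>x\<close> along \<open>closure S\<close>. On the closure,
    \<open>TS\<close> extends by continuity. The complement is invariant under \<open>A\<close>
    because \<open>S\<close> is invariant under the adjoint of \<open>A\<close>, and
    \<open>T\<close> vanishes there.\<close>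
  have "T (A x) = A (T x)" if A: "A \<in> N" for A x
  proof -
    note bA = N(1)[OF A]
    have "closure S \<subseteq> {x. T (A x) = A (T x)}"
    proof (rule closure_minimal)
      show "closed {x. T (A x) = A (T x)}"
        by (rule closed_Collect_eq[OF bop_UNIV_continuous[OF bop_UNIV_comp[OF T(1) bA]]
              bop_UNIV_continuous[OF bop_UNIV_comp[OF bA T(1)]]])
    qed (use TS[OF A] in auto)
    moreover define p where "p = oproj (closure S) x"
    moreover have "p \<in> closure S" unfolding p_def by (rule oproj_in[OF cS])
    ultimately have 1: "T (A p) = A (T p)" by blast
    have ort: "\<forall>s\<in>S. cinner (x - p) s = 0"
      unfolding p_def using oproj_orthogonal[OF cS] closure_subset by blast
    then have "\<forall>s\<in>S. cinner (A (x - p)) s = 0"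
      using AS[OF N(4)[OF A]] by (simp add: cinner_badj[OF bA])
    then have "T (A (x - p)) = A (T (x - p))" using T(3) ort bop_UNIV_zero[OF bA] by simp
    then show ?thesis using 1 by (simp add: bop_UNIV_diff bA T(1))
  qed
  then have "T \<in> bcomm UNIV N" using T(1) by (simp add: bcomm_def)
  moreover have "T (E x) = C x" for x
  proof -
    \<comment> \<open>The one-term list with the identity represents \<open>E x\<close> and is sent
      to \<open>C x\<close>.\<close>
    have l: "[(\<lambda>x. x, x)] \<in> L" using N(2) by (simp add: L_def)
    have "E x \<in> S" unfolding S_def by (rule image_eqI[OF _ l]) simp
    then show ?thesis using T(2) f[OF l] by simp
  qed
  ultimately show ?thesis by blast
qed

section \<open>O*-algebras\<close>

lemma Ldag_ext: "X \<in> Ldag D \<Longrightarrow> x \<notin> D \<Longrightarrow> X x = 0"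
  and Ldag_linear: "X \<in> Ldag D \<Longrightarrow> clinear_on D X"
  and Ldag_in: "X \<in> Ldag D \<Longrightarrow> x \<in> D \<Longrightarrow> X x \<in> D"
  by (auto simp: Ldag_def ext_on_def)

text \<open>The difference is itself a test vector. Formal adjoints are therefore unique also on E
  D, which need not be dense in the type.\<close>

lemma cinner_left_eqD:
  assumes "csubspace D" "\<zeta> \<in> D" "\<zeta>' \<in> D" "\<And>\<xi>. \<xi> \<in> D \<Longrightarrow> cinner \<xi> \<zeta> = cinner \<xi> \<zeta>'"
  shows "\<zeta> = (\<zeta>'::'a::chilbert)"
proof (rule cinner_eq_on_dense[of D])
  show "cinner \<zeta> s = cinner \<zeta>' s" if "s \<in> D" for s using assms(4)[OF that] by (metis cinner_commute)
  show "\<zeta> - \<zeta>' \<in> closure D" using csubspace_diff[OF assms(1-3)] closure_subset by blast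
qed

lemma dagger_eqI:
  assumes D: "csubspace D" and Y: "ext_on D Y" "\<And>\<eta>. \<eta> \<in> D \<Longrightarrow> Y \<eta> \<in> D"
    "\<And>\<xi> \<eta>. \<xi> \<in> D \<Longrightarrow> \<eta> \<in> D \<Longrightarrow> cinner (X \<xi>) \<eta> = cinner \<xi> (Y \<eta>)"
  shows "dagger D X = Y"
proof
  fix \<eta>
  show "dagger D X \<eta> = Y \<eta>"
  proof (cases "\<eta> \<in> D")
    case True
    have "(THE \<zeta>. \<zeta> \<in> D \<and> (\<forall>\<xi>\<in>D. cinner (X \<xi>) \<eta> = cinner \<xi> \<zeta>)) = Y \<eta>"
    proof (rule the_equality)
      show "Y \<eta> \<in> D \<and> (\<forall>\<xi>\<in>D. cinner (X \<xi>) \<eta> = cinner \<xi> (Y \<eta>))" using Y True by auto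
      show "\<zeta> = Y \<eta>" if "\<zeta> \<in> D \<and> (\<forall>\<xi>\<in>D. cinner (X \<xi>) \<eta> = cinner \<xi> \<zeta>)" for \<zeta>
        by (rule cinner_left_eqD[OF D]) (use that Y True in auto)
    qed
    then show ?thesis using True by (simp add: dagger_def)
  qed (use Y(1) in \<open>simp add: dagger_def ext_on_def\<close>)
qed

lemma
  assumes D: "csubspace D" and X: "X \<in> Ldag D"
  shows dagger_in: "\<eta> \<in> D \<Longrightarrow> dagger D X \<eta> \<in> D"
    and cinner_dagger: "\<xi> \<in> D \<Longrightarrow> \<eta> \<in> D \<Longrightarrow> cinner (X \<xi>) \<eta> = cinner \<xi> (dagger D X \<eta>)"
proof -
  have "\<forall>\<eta>\<in>D. \<exists>\<zeta>. \<zeta> \<in> D \<and> (\<forall>\<xi>\<in>D. cinner (X \<xi>) \<eta> = cinner \<xi> \<zeta>)"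
    using X unfolding Ldag_def by blast
  from bchoice[OF this] obtain Y
    where Y: "\<forall>\<eta>\<in>D. Y \<eta> \<in> D \<and> (\<forall>\<xi>\<in>D. cinner (X \<xi>) \<eta> = cinner \<xi> (Y \<eta>))" by blast
  have "dagger D X = restr D Y"
    by (rule dagger_eqI[OF D]) (use Y in \<open>auto simp: restr_def ext_on_def\<close>)
  then show "\<eta> \<in> D \<Longrightarrow> dagger D X \<eta> \<in> D"
    "\<xi> \<in> D \<Longrightarrow> \<eta> \<in> D \<Longrightarrow> cinner (X \<xi>) \<eta> = cinner \<xi> (dagger D X \<eta>)"
    using Y by (auto simp: restr_def)
qed

lemma cinner_dagger': "csubspace D \<Longrightarrow> X \<in> Ldag D \<Longrightarrow> \<xi> \<in> D \<Longrightarrow> \<eta> \<in> D \<Longrightarrow>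
    cinner (dagger D X \<eta>) \<xi> = cinner \<eta> (X \<xi>)"
  using cinner_dagger by (metis cinner_commute)

lemma dagger_dagger:
  assumes "csubspace D" "X \<in> Ldag D"
  shows "dagger D (dagger D X) = X"
  by (rule dagger_eqI[OF assms(1)])
    (use assms in \<open>auto simp: ext_on_def Ldag_ext Ldag_in cinner_dagger'\<close>)

lemma LdagI:
  assumes "ext_on D X" "clinear_on D X" "\<And>\<xi>. \<xi> \<in> D \<Longrightarrow> X \<xi> \<in> D"
    "\<And>\<eta>. \<eta> \<in> D \<Longrightarrow> Y \<eta> \<in> D" "\<And>\<xi> \<eta>. \<xi> \<in> D \<Longrightarrow> \<eta> \<in> D \<Longrightarrow> cinner (X \<xi>) \<eta> = cinner \<xi> (Y \<eta>)"
  shows "X \<in> Ldag D"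
  using assms unfolding Ldag_def by blast

lemma bop_eq_on_dense:
  assumes A: "bop UNIV A" and B: "bop UNIV B" and D: "closure D = UNIV"
    and eq: "\<And>x. x \<in> D \<Longrightarrow> A x = B x"
  shows "A = B"
proof -
  have "closure D \<subseteq> {x. A x = B x}"
    by (rule closure_minimal) (use eq in \<open>auto intro!: closed_Collect_eq bop_UNIV_continuous A B\<close>)
  then show ?thesis using D by auto
qed

text \<open>Justifies the definite description in \<open>bclos\<close>: existence by continuous
  extension, uniqueness by density of \<open>D\<close>.\<close>

lemma bclos:
  fixes D :: "'a::chilbert set"
  assumes D: "csubspace D" "closure D = UNIV" and X: "clinear_on D X"
    and b: "\<And>x. x \<in> D \<Longrightarrow> norm (X x) \<le> b * norm x"
  shows "bop UNIV (bclos UNIV D X)" "\<xi> \<in> D \<Longrightarrow> bclos UNIV D X \<xi> = X \<xi>"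
proof -
  have "norm (X x) \<le> \<bar>b\<bar> * norm x" if "x \<in> D" for x
    using b[OF that] by (smt (verit) mult_right_mono norm_ge_zero)
  then obtain A where A: "bop UNIV A" "\<forall>x\<in>D. A x = X x"
    using clinear_bounded_extension[OF D(1) X, of "\<bar>b\<bar>"] by auto
  have "bclos UNIV D X = A"
    unfolding bclos_def
  proof (rule the_equality)
    show "B = A" if "bop UNIV B \<and> (\<forall>\<xi>\<in>D. B \<xi> = X \<xi>)" for B
      by (rule bop_eq_on_dense[OF _ A(1) D(2)]) (use that A(2) in auto)
  qed (use A in simp)
  then show "bop UNIV (bclos UNIV D X)" "\<xi> \<in> D \<Longrightarrow> bclos UNIV D X \<xi> = X \<xi>" using A by auto
qed

section \<open>The weak commutant of a GW*-algebra\<close>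

lemma wcomm_bop: "C \<in> wcomm K D M \<Longrightarrow> bop K C"
  and wcomm_cinner: "C \<in> wcomm K D M \<Longrightarrow> X \<in> M \<Longrightarrow> \<xi> \<in> D \<Longrightarrow> \<eta> \<in> D \<Longrightarrow>
    cinner (C (X \<xi>)) \<eta> = cinner (C \<xi>) (dagger D X \<eta>)"
  by (auto simp: wcomm_def)

lemma OstarD:
  assumes "Ostar K D M"
  shows "csubspace D" "M \<subseteq> Ldag D" "X \<in> M \<Longrightarrow> Y \<in> M \<Longrightarrow> (\<lambda>x. X x + Y x) \<in> M"
    "X \<in> M \<Longrightarrow> (\<lambda>x. scaleC c (X x)) \<in> M" "X \<in> M \<Longrightarrow> Y \<in> M \<Longrightarrow> (\<lambda>x. X (Y x)) \<in> M"
    "X \<in> M \<Longrightarrow> dagger D X \<in> M"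
  using assms by (auto simp: Ostar_def)

lemma Ostar_UNIV_dense: "Ostar UNIV D M \<Longrightarrow> closure D = UNIV"
  by (auto simp: Ostar_def dense_in_def)

text \<open>Conjugate the weak relation for \<open>dagger D X\<close>, which belongs to
  \<open>M\<close>, with the two vectors interchanged.\<close>

lemma wcomm_badj:
  assumes O: "Ostar UNIV D M" and C: "C \<in> wcomm UNIV D M"
  shows "badj UNIV C \<in> wcomm UNIV D M"
proof -
  note bC = wcomm_bop[OF C] and D = OstarD(1)[OF O]
  have "cinner (badj UNIV C (X \<xi>)) \<eta> = cinner (badj UNIV C \<xi>) (dagger D X \<eta>)"
    if X: "X \<in> M" and v: "\<xi> \<in> D" "\<eta> \<in> D" for X \<xi> \<eta>
  proof -
    have L: "X \<in> Ldag D" using X OstarD(2)[OF O] by auto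
    have "cinner (C (dagger D X \<eta>)) \<xi> = cinner (C \<eta>) (X \<xi>)"
      using wcomm_cinner[OF C OstarD(6)[OF O X] v(2,1)] dagger_dagger[OF D L] by simp
    then show ?thesis unfolding cinner_badj'[OF bC] by (metis cinner_commute)
  qed
  then show ?thesis using bop_badj[OF bC] by (simp add: wcomm_def)
qed

text \<open>Once \<open>C \<xi>\<close> is in the domain, the adjoint in the weak relation can be
  moved back to \<open>C \<xi>\<close>, and density of \<open>D\<close> turns the weak relation into
  an identity of vectors.\<close>

lemma wcomm_intertwines:
  assumes G: "GWstar UNIV D M" and C: "C \<in> wcomm UNIV D M" and X: "X \<in> M" and \<xi>: "\<xi> \<in> D"
  shows "C \<xi> \<in> D" "C (X \<xi>) = X (C \<xi>)"
proof -
  have O: "Ostar UNIV D M" using G by (simp add: GWstar_def)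
  have L: "X \<in> Ldag D" using X OstarD(2)[OF O] by auto
  show CD: "C \<xi> \<in> D" using G C \<xi> by (auto simp: GWstar_def)
  show "C (X \<xi>) = X (C \<xi>)"
    by (rule cinner_eq_on_dense[of D])
      (use wcomm_cinner[OF C X \<xi>] cinner_dagger[OF OstarD(1)[OF O] L CD] Ostar_UNIV_dense[OF O] in auto)
qed

text \<open>It is not yet known that \<open>T \<xi>\<close> lies in \<open>D\<close>. But for fixed
  \<open>\<eta>\<close> the pairs in \<open>?H\<close> form a closed set containing the graph of
  \<open>X\<close>, hence also the pair of \<open>T \<xi>\<close> and \<open>T (X \<xi>)\<close>,
  which is the weak relation for \<open>T\<close>.\<close>

lemma wcomm_bicommutant:
  fixes D :: "'a::chilbert set"
  assumes G: "GWstar UNIV D M" and T: "T \<in> bcomm UNIV (bcomm UNIV (wcomm UNIV D M))"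
  shows "T \<in> wcomm UNIV D M"
proof -
  have O: "Ostar UNIV D M" using G by (simp add: GWstar_def)
  note D = OstarD(1)[OF O]
  have "cinner (T (X \<xi>)) \<eta> = cinner (T \<xi>) (dagger D X \<eta>)"
    if X: "X \<in> M" and v: "\<xi> \<in> D" "\<eta> \<in> D" for X \<xi> \<eta>
  proof -
    have L: "X \<in> Ldag D" using X OstarD(2)[OF O] by auto
    let ?H = "{z. cinner (snd z) \<eta> = cinner (fst z) (dagger D X \<eta>)} :: ('a \<times> 'a) set"
    have "(T \<xi>, T (X \<xi>)) \<in> closure ((\<lambda>\<zeta>. (\<zeta>, X \<zeta>)) ` D)"
      by (rule bicommutant_preserves_closed_graph[OF wcomm_bop wcomm_badj[OF O] D Ldag_linear[OF L] _ T v(1)])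
        (use wcomm_intertwines[OF G _ X] in auto)
    moreover have "closure ((\<lambda>\<zeta>. (\<zeta>, X \<zeta>)) ` D) \<subseteq> ?H"
    proof (rule closure_minimal)
      show "(\<lambda>\<zeta>. (\<zeta>, X \<zeta>)) ` D \<subseteq> ?H" using cinner_dagger[OF D L _ v(2)] by auto
      show "closed ?H" by (intro closed_Collect_eq continuous_on_cinner continuous_intros)
    qed
    ultimately show ?thesis by auto
  qed
  then show ?thesis using bcomm_bop[OF T] by (simp add: wcomm_def)
qed

section \<open>Completeness in the graph topology\<close>

lemma tM_cauchy_principal: "\<xi> \<in> D \<Longrightarrow> tM_cauchy M D (principal {\<xi>})"
  by (auto simp: tM_cauchy_def eventually_principal principal_eq_bot_iff principal_prod_principal)

lemma tM_cauchy_limits: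
  assumes cl: "closed_O M D" and F: "tM_cauchy M D F" and lim: "((\<lambda>x. x) \<longlongrightarrow> \<xi>) F"
  shows "\<xi> \<in> D" "X \<in> M \<Longrightarrow> (X \<longlongrightarrow> X \<xi>) F"
proof -
  from cl F obtain \<xi>' where *: "\<xi>' \<in> D" "((\<lambda>x. x) \<longlongrightarrow> \<xi>') F" "\<forall>X\<in>M. (X \<longlongrightarrow> X \<xi>') F"
    by (auto simp: closed_O_def)
  have "F \<noteq> bot" using F by (simp add: tM_cauchy_def)
  then have "\<xi>' = \<xi>" using tendsto_unique *(2) lim by blast
  then show "\<xi> \<in> D" "X \<in> M \<Longrightarrow> (X \<longlongrightarrow> X \<xi>) F" using * by auto
qed

lemma Dtilde_closed_O:
  assumes cl: "closed_O M D"
  shows "Dtilde M D = D"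
proof
  show "Dtilde M D \<subseteq> D" using tM_cauchy_limits(1)[OF cl] by (auto simp: Dtilde_def)
  show "D \<subseteq> Dtilde M D"
    using tM_cauchy_principal by (fastforce simp: Dtilde_def filterlim_def le_nhds eventually_principal)
qed

text \<open>Every Cauchy filter tending to \<open>\<xi>\<close> carries \<open>X\<close> to
  \<open>X \<xi>\<close>, and the principal filter at \<open>\<xi>\<close> is one such filter. Off
  \<open>D\<close> both functions are zero by convention.\<close>

lemma closure_alg_closed_O:
  assumes cl: "closed_O M D" and ext: "\<And>X. X \<in> M \<Longrightarrow> ext_on D X"
  shows "closure_alg M D = M"
proof -
  have "closure_op M D X = X" if X: "X \<in> M" for X
  proof
    fix \<xi>
    show "closure_op M D X \<xi> = X \<xi>"
    proof (cases "\<xi> \<in> D")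
      case True
      have "(THE \<zeta>. \<exists>F. tM_cauchy M D F \<and> ((\<lambda>x. x) \<longlongrightarrow> \<xi>) F \<and> (X \<longlongrightarrow> \<zeta>) F) = X \<xi>"
      proof (rule the_equality)
        show "\<exists>F. tM_cauchy M D F \<and> ((\<lambda>x. x) \<longlongrightarrow> \<xi>) F \<and> (X \<longlongrightarrow> X \<xi>) F"
          using tM_cauchy_principal[OF True]
          by (intro exI[of _ "principal {\<xi>}"]) (auto simp: filterlim_def le_nhds eventually_principal eventually_filtermap)
      next
        fix \<zeta> assume "\<exists>F. tM_cauchy M D F \<and> ((\<lambda>x. x) \<longlongrightarrow> \<xi>) F \<and> (X \<longlongrightarrow> \<zeta>) F"
        then obtain F where F: "tM_cauchy M D F" "((\<lambda>x. x) \<longlongrightarrow> \<xi>) F" "(X \<longlongrightarrow> \<zeta>) F" by blast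
        have "F \<noteq> bot" using F(1) by (simp add: tM_cauchy_def)
        then show "\<zeta> = X \<xi>" using tendsto_unique F(3) tM_cauchy_limits(2)[OF cl F(1,2) X] by blast
      qed
      then show ?thesis using True by (simp add: closure_op_def Dtilde_closed_O[OF cl])
    next
      case False
      then show ?thesis using ext[OF X] by (simp add: closure_op_def Dtilde_closed_O[OF cl] ext_on_def)
    qed
  qed
  then show ?thesis by (force simp: closure_alg_def)
qed

section \<open>Reduction of the algebra by a projection\<close>

locale GWstar_projection =
  fixes M :: "('a::chilbert \<Rightarrow> 'a) set" and D :: "'a set" and E :: "'a \<Rightarrow> 'a"
  assumes GW: "GWstar UNIV D M"
    and proj: "is_projection UNIV E"
    and EM: "restr D E \<in> M"
begin

lemma O: "Ostar UNIV D M" and clM: "closed_O M D" and bicM: "M = wbicomm_c UNIV D M"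
  using GW by (auto simp: GWstar_def)

lemma D: "csubspace D" and dense: "closure D = UNIV"
  using OstarD(1)[OF O] Ostar_UNIV_dense[OF O] by auto

lemma M_Ldag: "X \<in> M \<Longrightarrow> X \<in> Ldag D"
  using OstarD(2)[OF O] by auto

lemma bE: "bop UNIV E" and E_idem: "E (E x) = E x"
  using proj by (auto simp: is_projection_def)

lemma cinner_E: "cinner (E x) y = cinner x (E y)"
  using cinner_badj[OF bE] proj by (simp add: is_projection_def)

lemma E_fixes: "x \<in> range E \<Longrightarrow> E x = x"
  using E_idem by auto

lemma E_in: "x \<in> D \<Longrightarrow> E x \<in> D"
  using Ldag_in[OF M_Ldag[OF EM]] by (auto simp: restr_def)

text \<open>Together: E D is the intersection of \<open>D\<close> with
  \<open>range E\<close>.\<close>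

lemma ED_sub: "x \<in> E ` D \<Longrightarrow> x \<in> D" and ED_fix: "x \<in> E ` D \<Longrightarrow> E x = x"
  and ED_I: "x \<in> D \<Longrightarrow> E x = x \<Longrightarrow> x \<in> E ` D"
  using E_in E_idem by (auto intro: rev_image_eqI)

lemma csubspace_ED: "csubspace (E ` D)"
  unfolding csubspace_def
proof (intro conjI ballI allI)
  show "0 \<in> E ` D" using csubspace_0[OF D] bop_UNIV_zero[OF bE] by (intro ED_I)
next
  fix x y assume xy: "x \<in> E ` D" "y \<in> E ` D"
  show "x + y \<in> E ` D"
    using csubspace_add[OF D ED_sub[OF xy(1)] ED_sub[OF xy(2)]] ED_fix[OF xy(1)] ED_fix[OF xy(2)]
    by (intro ED_I) (simp_all add: bop_add[OF bE])
next
  fix c x assume x: "x \<in> E ` D"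
  show "scaleC c x \<in> E ` D"
    using csubspace_scaleC[OF D ED_sub[OF x]] ED_fix[OF x]
    by (intro ED_I) (simp_all add: bop_scaleC[OF bE])
qed

lemma csubspace_rangeE: "csubspace (range E)"
  unfolding csubspace_def
proof (intro conjI ballI allI)
  show "0 \<in> range E" using bop_UNIV_zero[OF bE] by (metis rangeI)
  show "x + y \<in> range E" if "x \<in> range E" "y \<in> range E" for x y
    using that bop_add[OF bE] by (metis (no_types, lifting) UNIV_I imageE rangeI)
  show "scaleC c x \<in> range E" if "x \<in> range E" for c x
    using that bop_scaleC[OF bE] by (metis (no_types, lifting) UNIV_I imageE rangeI)
qed

lemma hilbert_rangeE: "hilbert_sub (range E)"
proof -
  have "range E = {x. E x = x}" using E_idem by (auto intro: range_eqI[OF sym])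
  then have "closed (range E)"
    using closed_Collect_eq[OF bop_UNIV_continuous[OF bE] continuous_on_id] by simp
  then show ?thesis using csubspace_rangeE by (simp add: hilbert_sub_def)
qed

lemma dense_ED: "dense_in (E ` D) (range E)"
proof -
  have "E ` closure D \<subseteq> closure (E ` D)"
    by (rule image_closure_subset) (auto intro: bop_UNIV_continuous[OF bE] closure_subset[THEN subsetD])
  then show ?thesis using dense by (auto simp: dense_in_def)
qed

lemma eq_on_ED:
  assumes "x \<in> range E" "y \<in> range E" "\<And>s. s \<in> E ` D \<Longrightarrow> cinner x s = cinner y s"
  shows "x = y"
  by (rule cinner_eq_on_dense[OF assms(3)])
    (use csubspace_diff[OF csubspace_rangeE assms(1,2)] dense_ED in \<open>auto simp: dense_in_def\<close>)

definition red :: "('a \<Rightarrow> 'a) \<Rightarrow> 'a \<Rightarrow> 'a" where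
  "red X = restr (E ` D) (\<lambda>x. E (X x))"

lemma red_apply: "x \<in> E ` D \<Longrightarrow> red X x = E (X x)" and red_out: "x \<notin> E ` D \<Longrightarrow> red X x = 0"
  by (simp_all add: red_def restr_def)

lemma ME_eq: "ME D E M = red ` M"
  by (simp add: ME_def red_def)

lemma red_in: "X \<in> M \<Longrightarrow> x \<in> E ` D \<Longrightarrow> red X x \<in> E ` D"
  using Ldag_in[OF M_Ldag] ED_sub by (auto simp: red_apply)

lemma cinner_red:
  assumes X: "X \<in> M" and v: "\<xi> \<in> E ` D" "\<eta> \<in> E ` D"
  shows "cinner (red X \<xi>) \<eta> = cinner \<xi> (red (dagger D X) \<eta>)"
proof -
  have "cinner (red X \<xi>) \<eta> = cinner (X \<xi>) \<eta>"
    using v(1) ED_fix[OF v(2)] by (simp add: red_apply cinner_E)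
  also have "\<dots> = cinner (E \<xi>) (dagger D X \<eta>)"
    using cinner_dagger[OF D M_Ldag[OF X] ED_sub[OF v(1)] ED_sub[OF v(2)]] ED_fix[OF v(1)] by simp
  also have "\<dots> = cinner \<xi> (red (dagger D X) \<eta>)" using v by (simp add: red_apply cinner_E)
  finally show ?thesis .
qed

lemma dagger_red:
  assumes X: "X \<in> M" shows "dagger (E ` D) (red X) = red (dagger D X)"
  by (rule dagger_eqI[OF csubspace_ED])
    (use red_in[OF OstarD(6)[OF O X]] cinner_red[OF X] in \<open>auto simp: ext_on_def red_out\<close>)

lemma red_Ldag:
  assumes X: "X \<in> M" shows "red X \<in> Ldag (E ` D)"
proof (rule LdagI[of _ _ "red (dagger D X)"])
  show "clinear_on (E ` D) (red X)"
    using Ldag_linear[OF M_Ldag[OF X]] csubspace_ED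
    by (auto simp: clinear_on_def red_apply csubspace_add csubspace_scaleC ED_sub bop_add[OF bE] bop_scaleC[OF bE])
qed (use red_in[OF X] red_in[OF OstarD(6)[OF O X]] cinner_red[OF X] in \<open>auto simp: ext_on_def red_out\<close>)

lemma Ostar_ME: "Ostar (range E) (E ` D) (ME D E M)"
  unfolding Ostar_def ME_eq
proof (intro conjI ballI allI)
  show "hilbert_sub (range E)" "csubspace (E ` D)" "dense_in (E ` D) (range E)"
    by (rule hilbert_rangeE csubspace_ED dense_ED)+
  show "red ` M \<subseteq> Ldag (E ` D)" using red_Ldag by auto
  show "red ` M \<noteq> {}" using EM by auto
next
  fix X' Y' assume "X' \<in> red ` M" "Y' \<in> red ` M"
  then obtain X Y where X: "X \<in> M" "X' = red X" and Y: "Y \<in> M" "Y' = red Y" by auto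
  have "(\<lambda>x. X' x + Y' x) = red (\<lambda>x. X x + Y x)"
    by (auto simp: X Y red_def restr_def bop_add[OF bE])
  then show "(\<lambda>x. X' x + Y' x) \<in> red ` M" using OstarD(3)[OF O X(1) Y(1)] by simp
  \<comment> \<open>The compression is not multiplicative; the product of two compressions is the
    compression of X E Y, and this is in \<open>M\<close> because the restriction of
    \<open>E\<close> is.\<close>
  have "(\<lambda>x. X' (Y' x)) = red (\<lambda>x. X (restr D E (Y x)))"
  proof
    fix x
    show "X' (Y' x) = red (\<lambda>x. X (restr D E (Y x))) x"
    proof (cases "x \<in> E ` D")
      case True
      have "Y x \<in> D" using Ldag_in[OF M_Ldag[OF Y(1)] ED_sub[OF True]] .
      then show ?thesis using red_in[OF Y(1) True] True by (simp add: X Y red_apply restr_def)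
    next
      case False
      have "0 \<in> E ` D" using csubspace_0[OF csubspace_ED] .
      moreover have "X 0 = 0"
        using Ldag_linear[OF M_Ldag[OF X(1)]] csubspace_0[OF D] scaleC_zero_left unfolding clinear_on_def by metis
      ultimately show ?thesis using False by (simp add: X Y red_out red_apply bop_UNIV_zero[OF bE])
    qed
  qed
  then show "(\<lambda>x. X' (Y' x)) \<in> red ` M"
    using OstarD(5)[OF O X(1) OstarD(5)[OF O EM Y(1)]] by simp
next
  fix c X' assume "X' \<in> red ` M"
  then obtain X where X: "X \<in> M" "X' = red X" by auto
  have "(\<lambda>x. scaleC c (X' x)) = red (\<lambda>x. scaleC c (X x))"
    by (auto simp: X red_def restr_def bop_scaleC[OF bE])
  then show "(\<lambda>x. scaleC c (X' x)) \<in> red ` M" using OstarD(4)[OF O X(1)] by simp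
  show "dagger (E ` D) X' \<in> red ` M" using X dagger_red OstarD(6)[OF O] by simp
qed

lemma norm_sq_le_red:
  assumes X: "X \<in> M" and x: "x \<in> E ` D"
  shows "(norm (X x))\<^sup>2 \<le> norm (red (\<lambda>x. dagger D X (X x)) x) * norm x"
proof -
  have xD: "x \<in> D" "X x \<in> D" using ED_sub[OF x] Ldag_in[OF M_Ldag[OF X]] by auto
  have "(norm (X x))\<^sup>2 = cmod (cinner (X x) (X x))" by (simp add: cinner_self norm_power)
  also have "cinner (X x) (X x) = cinner (dagger D X (X x)) x"
    using cinner_dagger'[OF D M_Ldag[OF X] xD] by simp
  also have "\<dots> = cinner (red (\<lambda>x. dagger D X (X x)) x) x"
    using x ED_fix[OF x] by (simp add: red_apply cinner_E)
  finally show ?thesis using cinner_Cauchy_Schwarz by metis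
qed

lemma Ldag_diff:
  assumes "X \<in> Ldag D" "x \<in> D" "y \<in> D" shows "X (x - y) = X x - X y"
proof -
  have "X (x + scaleC (-1) y) = X x + scaleC (-1) (X y)"
    using Ldag_linear[OF assms(1)] assms(2,3) csubspace_scaleC[OF D] unfolding clinear_on_def by metis
  then show ?thesis by (simp add: scaleC_minus_one)
qed

lemma closed_ME: "closed_O (ME D E M) (E ` D)"
  unfolding closed_O_def
proof (intro allI impI)
  fix F assume F: "tM_cauchy (ME D E M) (E ` D) F"
  have Fne: "F \<noteq> bot" and FE: "eventually (\<lambda>x. x \<in> E ` D) F"
    and Fn: "\<And>e. e > 0 \<Longrightarrow> eventually (\<lambda>(x, y). norm (x - y) < e) (F \<times>\<^sub>F F)"
    and FX: "\<And>X e. X \<in> M \<Longrightarrow> e > 0 \<Longrightarrow> eventually (\<lambda>(x, y). norm (red X x - red X y) < e) (F \<times>\<^sub>F F)"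
    using F by (auto simp: tM_cauchy_def ME_eq)
  have FEE: "eventually (\<lambda>(x, y). x \<in> E ` D \<and> y \<in> E ` D) (F \<times>\<^sub>F F)"
    using FE eventually_prod_filter by fastforce
  have "eventually (\<lambda>(x, y). norm (X x - X y) < e) (F \<times>\<^sub>F F)" if X: "X \<in> M" and e: "e > 0" for X e
  proof -
    let ?Y = "\<lambda>x. dagger D X (X x)"
    have Y: "?Y \<in> M" using OstarD(5)[OF O OstarD(6)[OF O X] X] .
    \<comment> \<open>\<open>norm_sq_le_red\<close> bounds the square of the
      \<open>X\<close>-seminorm by a product. Tolerance e^2 for \<open>red ?Y\<close> and 1 for the
      norm make that product smaller than e^2.\<close>
    have "eventually (\<lambda>(x, y). norm (red ?Y x - red ?Y y) < e\<^sup>2) (F \<times>\<^sub>F F)" using FX[OF Y] e by simp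
    moreover have "eventually (\<lambda>(x, y). norm (x - y) < 1) (F \<times>\<^sub>F F)" using Fn by simp
    ultimately show ?thesis using FEE
    proof eventually_elim
      case (elim p)
      obtain x y where p: "p = (x, y)" by force
      have xy: "x \<in> E ` D" "y \<in> E ` D" and l1: "norm (x - y) < 1"
        and l2: "norm (red ?Y x - red ?Y y) < e\<^sup>2" using elim p by auto
      have d: "x - y \<in> E ` D" by (rule csubspace_diff[OF csubspace_ED xy])
      have "red ?Y (x - y) = red ?Y x - red ?Y y"
        using xy d Ldag_diff[OF M_Ldag[OF Y]] ED_sub by (simp add: red_apply bop_UNIV_diff[OF bE])
      then have "(norm (X (x - y)))\<^sup>2 \<le> norm (red ?Y x - red ?Y y) * norm (x - y)"
        using norm_sq_le_red[OF X d] by simp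
      also have "\<dots> \<le> norm (red ?Y x - red ?Y y)" using l1 by (simp add: mult_left_le)
      finally have "(norm (X (x - y)))\<^sup>2 < e\<^sup>2" using l2 by simp
      then have "norm (X (x - y)) < e" using e by (simp add: power_less_imp_less_base)
      then show ?case using p Ldag_diff[OF M_Ldag[OF X]] xy ED_sub by simp
    qed
  qed
  then have "tM_cauchy M D F"
    using Fne Fn eventually_mono[OF FE ED_sub] by (simp add: tM_cauchy_def)
  then obtain \<xi> where \<xi>: "\<xi> \<in> D" "((\<lambda>x. x) \<longlongrightarrow> \<xi>) F" "\<And>X. X \<in> M \<Longrightarrow> (X \<longlongrightarrow> X \<xi>) F"
    using clM by (auto simp: closed_O_def)
  \<comment> \<open>\<open>E\<close> is the identity on the sets where the filter lives, so the
    limit, found in \<open>D\<close> by completeness of \<open>M\<close>, is fixed by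
    \<open>E\<close>.\<close>
  have "((\<lambda>x. E x) \<longlongrightarrow> E \<xi>) F" by (rule bop_UNIV_tendsto[OF bE \<xi>(2)])
  then have "((\<lambda>x. x) \<longlongrightarrow> E \<xi>) F"
    by (rule Lim_transform_eventually) (rule eventually_mono[OF FE ED_fix])
  then have "E \<xi> = \<xi>" using tendsto_unique[OF Fne] \<xi>(2) by blast
  then have \<xi>E: "\<xi> \<in> E ` D" using ED_I \<xi>(1) by blast
  have "(red X \<longlongrightarrow> red X \<xi>) F" if X: "X \<in> M" for X
  proof (rule Lim_transform_eventually)
    show "((\<lambda>x. E (X x)) \<longlongrightarrow> red X \<xi>) F"
      using bop_UNIV_tendsto[OF bE \<xi>(3)[OF X]] by (simp add: red_apply[OF \<xi>E])
    show "eventually (\<lambda>x. E (X x) = red X x) F" by (rule eventually_mono[OF FE]) (simp add: red_apply)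
  qed
  then show "\<exists>\<xi>\<in>E ` D. ((\<lambda>x. x) \<longlongrightarrow> \<xi>) F \<and> (\<forall>X\<in>ME D E M. (X \<longlongrightarrow> X \<xi>) F)"
    using \<xi>(2) \<xi>E by (auto simp: ME_eq)
qed

section \<open>Weak commutant and bicommutant of the reduced algebra\<close>

lemma wcomm_commutes_E:
  assumes C: "C \<in> wcomm UNIV D M" shows "C (E x) = E (C x)"
proof -
  have "(\<lambda>x. C (E x)) = (\<lambda>x. E (C x))"
  proof (rule bop_eq_on_dense[OF _ _ dense])
    fix \<xi> assume \<xi>: "\<xi> \<in> D"
    show "C (E \<xi>) = E (C \<xi>)" using wcomm_intertwines[OF GW C EM \<xi>] \<xi> by (simp add: restr_def)
  qed (rule bop_UNIV_comp[OF wcomm_bop[OF C] bE] bop_UNIV_comp[OF bE wcomm_bop[OF C]])+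
  then show ?thesis by metis
qed

text \<open>Supplies the test operators for the bicommutant: what commutes weakly with the weak
  commutant of M_E can be tested against all restrictions of M'_w.\<close>

lemma wcomm_restr:
  assumes C: "C \<in> wcomm UNIV D M"
  shows "restr (range E) C \<in> wcomm (range E) (E ` D) (ME D E M)"
proof -
  note bC = wcomm_bop[OF C]
  let ?C = "restr (range E) C"
  have CE: "C x \<in> range E" if "x \<in> range E" for x
    using that by (auto simp: wcomm_commutes_E[OF C])
  have "bop (range E) ?C"
  proof -
    obtain c where "\<And>x. norm (C x) \<le> c * norm x" using bop_bound[OF bC] by auto
    then have "\<exists>c. \<forall>x\<in>range E. norm (?C x) \<le> c * norm x" by (intro exI[of _ c]) (auto simp: restr_def)
    moreover have "?C ` range E \<subseteq> range E" using CE by (auto simp: restr_def)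
    moreover have "clinear_on (range E) ?C"
      using csubspace_add[OF csubspace_rangeE] csubspace_scaleC[OF csubspace_rangeE]
      unfolding clinear_on_def restr_def by (simp add: bop_add[OF bC] bop_scaleC[OF bC])
    ultimately show ?thesis by (simp add: bop_def ext_on_def restr_def)
  qed
  moreover have "cinner (?C (red X \<xi>)) \<eta> = cinner (?C \<xi>) (dagger (E ` D) (red X) \<eta>)"
    if X: "X \<in> M" and v: "\<xi> \<in> E ` D" "\<eta> \<in> E ` D" for X \<xi> \<eta>
  proof -
    have "red X \<xi> \<in> range E" "\<xi> \<in> range E" using red_in[OF X v(1)] v by auto
    then have "cinner (?C (red X \<xi>)) \<eta> = cinner (C (E (X \<xi>))) \<eta>" using v by (simp add: restr_def red_apply)
    also have "\<dots> = cinner (C (X \<xi>)) \<eta>" using ED_fix[OF v(2)] by (simp add: wcomm_commutes_E[OF C] cinner_E)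
    also have "\<dots> = cinner (C (E \<xi>)) (dagger D X \<eta>)"
      using wcomm_cinner[OF C X ED_sub[OF v(1)] ED_sub[OF v(2)]] ED_fix[OF v(1)] by simp
    also have "\<dots> = cinner (C \<xi>) (E (dagger D X \<eta>))" by (simp add: wcomm_commutes_E[OF C] cinner_E)
    also have "\<dots> = cinner (?C \<xi>) (dagger (E ` D) (red X) \<eta>)"
      using v \<open>\<xi> \<in> range E\<close> by (simp add: dagger_red[OF X] red_apply restr_def)
    finally show ?thesis .
  qed
  ultimately show ?thesis by (auto simp: wcomm_def ME_eq)
qed

lemma ME_bicommutant: "ME D E M = wbicomm_c (range E) (E ` D) (ME D E M)"
proof
  show "ME D E M \<subseteq> wbicomm_c (range E) (E ` D) (ME D E M)"
    using OstarD(2)[OF Ostar_ME] wcomm_cinner by (fastforce simp: wbicomm_c_def)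
  show "wbicomm_c (range E) (E ` D) (ME D E M) \<subseteq> ME D E M"
  proof
    fix X assume "X \<in> wbicomm_c (range E) (E ` D) (ME D E M)"
    then have X: "X \<in> Ldag (E ` D)"
      and Xc: "\<And>C \<xi> \<eta>. C \<in> wcomm (range E) (E ` D) (ME D E M) \<Longrightarrow> \<xi> \<in> E ` D \<Longrightarrow> \<eta> \<in> E ` D \<Longrightarrow>
        cinner (C (X \<xi>)) \<eta> = cinner (C \<xi>) (dagger (E ` D) X \<eta>)"
      by (auto simp: wbicomm_c_def)
    \<comment> \<open>\<open>Y\<close> continues \<open>X\<close> by zero on the part of
      \<open>D\<close> orthogonal to \<open>range E\<close>, and \<open>Z\<close> does the same for
      its adjoint; \<open>Z\<close> becomes the adjoint of \<open>Y\<close>.\<close>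
    define Y where "Y = restr D (\<lambda>x. X (E x))"
    define Z where "Z = restr D (\<lambda>x. dagger (E ` D) X (E x))"
    have XE: "X x \<in> E ` D" "dagger (E ` D) X x \<in> E ` D" if "x \<in> E ` D" for x
      using Ldag_in[OF X that] dagger_in[OF csubspace_ED X that] by auto
    have YZ: "cinner (Y \<xi>) \<eta> = cinner \<xi> (Z \<eta>)" if v: "\<xi> \<in> D" "\<eta> \<in> D" for \<xi> \<eta>
    proof -
      have vE: "E \<xi> \<in> E ` D" "E \<eta> \<in> E ` D" using v by auto
      have "cinner (Y \<xi>) \<eta> = cinner (E (X (E \<xi>))) \<eta>" using v ED_fix[OF XE(1)[OF vE(1)]] by (simp add: Y_def restr_def)
      also have "\<dots> = cinner (X (E \<xi>)) (E \<eta>)" by (simp add: cinner_E)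
      also have "\<dots> = cinner (E \<xi>) (dagger (E ` D) X (E \<eta>))" by (rule cinner_dagger[OF csubspace_ED X vE])
      also have "\<dots> = cinner \<xi> (Z \<eta>)" using v ED_fix[OF XE(2)[OF vE(2)]] by (simp add: cinner_E Z_def restr_def)
      finally show ?thesis .
    qed
    have Yin: "Y x \<in> D" "Z x \<in> D" if "x \<in> D" for x
      using that XE[of "E x"] ED_sub by (auto simp: Y_def Z_def restr_def)
    have YL: "Y \<in> Ldag D"
    proof (rule LdagI[of _ _ Z])
      show "clinear_on D Y"
        using Ldag_linear[OF X] csubspace_add[OF D] csubspace_scaleC[OF D]
        by (simp add: clinear_on_def Y_def restr_def bop_add[OF bE] bop_scaleC[OF bE])
      show "ext_on D Y" by (simp add: ext_on_def Y_def restr_def)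
    qed (use Yin YZ in auto)
    have dY: "dagger D Y = Z"
      by (rule dagger_eqI[OF D]) (use Yin YZ in \<open>auto simp: ext_on_def Z_def restr_def\<close>)
    have "cinner (C (Y \<xi>)) \<eta> = cinner (C \<xi>) (dagger D Y \<eta>)"
      if C: "C \<in> wcomm UNIV D M" and v: "\<xi> \<in> D" "\<eta> \<in> D" for C \<xi> \<eta>
    proof -
      have vE: "E \<xi> \<in> E ` D" "E \<eta> \<in> E ` D" using v by auto
      let ?C = "restr (range E) C"
      have Cr: "?C x = C x" if "x \<in> E ` D" for x using that by (auto simp: restr_def)
      have "cinner (C (Y \<xi>)) \<eta> = cinner (C (E (X (E \<xi>)))) \<eta>"
        using v ED_fix[OF XE(1)[OF vE(1)]] by (simp add: Y_def restr_def)
      also have "\<dots> = cinner (?C (X (E \<xi>))) (E \<eta>)"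
        using Cr[OF XE(1)[OF vE(1)]] by (simp add: wcomm_commutes_E[OF C] cinner_E)
      also have "\<dots> = cinner (?C (E \<xi>)) (dagger (E ` D) X (E \<eta>))"
        by (rule Xc[OF wcomm_restr[OF C] vE])
      also have "\<dots> = cinner (C \<xi>) (E (dagger (E ` D) X (E \<eta>)))"
        using Cr[OF vE(1)] by (simp add: wcomm_commutes_E[OF C] cinner_E)
      also have "\<dots> = cinner (C \<xi>) (dagger D Y \<eta>)"
        using v ED_fix[OF XE(2)[OF vE(2)]] by (simp add: dY Z_def restr_def)
      finally show ?thesis .
    qed
    then have YM: "Y \<in> M" using bicM YL by (auto simp: wbicomm_c_def)
    have "X = red Y"
    proof
      fix x
      show "X x = red Y x"
      proof (cases "x \<in> E ` D")
        case True
        then show ?thesis using ED_fix[OF True] ED_sub[OF True] ED_fix[OF XE(1)[OF True]]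
          by (simp add: red_apply Y_def restr_def)
      qed (simp add: red_out Ldag_ext[OF X])
    qed
    then show "X \<in> ME D E M" using YM by (simp add: ME_eq)
  qed
qed

lemma wcomm_ME_extends:
  assumes sd: "bcomm UNIV (wcomm UNIV D M) \<subseteq> sstar_closure UNIV (bclos UNIV D ` Mb D M)"
    and C: "C \<in> wcomm (range E) (E ` D) (ME D E M)"
  shows "\<exists>T\<in>wcomm UNIV D M. \<forall>x. T (E x) = C (E x)"
proof -
  let ?N = "bcomm UNIV (wcomm UNIV D M)"
  note bC = wcomm_bop[OF C]
  \<comment> \<open>\<open>C\<close> precomposed with \<open>E\<close>: an operator on the whole
    space, as the extension lemma requires, that is zero on the complement of
    \<open>range E\<close>.\<close>
  define C0 where "C0 x = C (E x)" for x
  have C0E: "C0 (E x) = C0 x" for x by (simp add: C0_def E_idem)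
  have Cr: "C x \<in> range E" if "x \<in> range E" for x using bop_in[OF bC that] .
  have EC0: "E (C0 x) = C0 x" for x by (rule E_fixes) (simp add: C0_def Cr)
  have bC0: "bop UNIV C0"
  proof -
    obtain c where c: "c > 0" "\<And>x. x \<in> range E \<Longrightarrow> norm (C x) \<le> c * norm x" using bop_bound[OF bC] by auto
    obtain b where b: "\<And>x. norm (E x) \<le> b * norm x" using bop_bound[OF bE] by auto
    show ?thesis
    proof (rule bop_UNIV_I[of _ "c * b"])
      fix x y :: 'a and k
      show "C0 (x + y) = C0 x + C0 y" by (simp add: C0_def bop_add[OF bE] bop_add[OF bC])
      show "C0 (scaleC k x) = scaleC k (C0 x)" by (simp add: C0_def bop_scaleC[OF bE] bop_scaleC[OF bC])
      show "norm (C0 x) \<le> c * b * norm x"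
        using order_trans[OF c(2)[of "E x"] mult_left_mono[OF b[of x], of c]] c(1)
        by (simp add: C0_def mult.assoc)
    qed
  qed
  \<comment> \<open>For a bounded \<open>X\<close> in \<open>M\<close> the adjoint of its closure
    agrees with \<open>dagger D X\<close> on \<open>D\<close>. The right side can therefore be
    rewritten although \<open>C \<xi>\<close> is not known to lie in \<open>D\<close>.\<close>
  have Mbcom: "cinner (C (E (B \<xi>))) \<eta> = cinner (E (B (C \<xi>))) \<eta>"
    if B: "B \<in> bclos UNIV D ` Mb D M" and v: "\<xi> \<in> E ` D" "\<eta> \<in> E ` D" for B \<xi> \<eta>
  proof -
    obtain X c where X: "X \<in> M" "B = bclos UNIV D X" "\<forall>\<xi>\<in>D. norm (X \<xi>) \<le> c * norm \<xi>"
      using B by (auto simp: Mb_def)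
    note BX = bclos[OF D dense Ldag_linear[OF M_Ldag[OF X(1)]], of c]
    have bB: "bop UNIV B" and BD: "\<And>\<xi>. \<xi> \<in> D \<Longrightarrow> B \<xi> = X \<xi>" using BX X by auto
    have vD: "\<xi> \<in> D" "\<eta> \<in> D" using v ED_sub by auto
    have adj: "badj UNIV B \<eta> = dagger D X \<eta>"
      by (rule cinner_eq_on_dense[of D])
        (use BD cinner_badj'[OF bB] cinner_dagger'[OF D M_Ldag[OF X(1)] _ vD(2)] dense in auto)
    have "cinner (C (E (B \<xi>))) \<eta> = cinner (C (red X \<xi>)) \<eta>" using BD vD v by (simp add: red_apply)
    also have "\<dots> = cinner (C \<xi>) (dagger (E ` D) (red X) \<eta>)"
      by (rule wcomm_cinner[OF C _ v]) (use X in \<open>simp add: ME_eq\<close>)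
    also have "\<dots> = cinner (E (C \<xi>)) (dagger D X \<eta>)"
      using v(2) by (simp add: dagger_red[OF X(1)] red_apply cinner_E)
    also have "E (C \<xi>) = C \<xi>"
    proof (rule E_fixes[OF Cr])
      show "\<xi> \<in> range E" using v(1) by blast
    qed
    also have "cinner (C \<xi>) (dagger D X \<eta>) = cinner (B (C \<xi>)) \<eta>" by (simp add: cinner_badj[OF bB] adj)
    also have "\<dots> = cinner (E (B (C \<xi>))) \<eta>" using ED_fix[OF v(2)] by (simp add: cinner_E)
    finally show ?thesis .
  qed
  have comm: "C0 (E (A (E x))) = E (A (C0 x))" if A: "A \<in> ?N" for A x
  proof -
    note bA = bcomm_bop[OF A]
    have "(\<lambda>x. C0 (E (A (E x)))) = (\<lambda>x. E (A (C0 x)))"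
    proof (rule bop_eq_on_dense[OF _ _ dense])
      fix x assume x: "x \<in> D"
      let ?\<xi> = "E x"
      \<comment> \<open>The approximants are evaluated at just two vectors, \<open>E x\<close> and
        its image under \<open>C\<close>, so a finite set of seminorms and a sequence of
        approximants suffice.\<close>
      have "\<exists>B\<in>bclos UNIV D ` Mb D M. \<forall>\<xi>\<in>{?\<xi>, C ?\<xi>}. norm (A \<xi> - B \<xi>) + norm (badj UNIV (\<lambda>x. A x - B x) \<xi>) < 1 / real (Suc n)" for n
      proof -
        have "A \<in> sstar_closure UNIV (bclos UNIV D ` Mb D M)" using sd A by blast
        moreover have "finite {?\<xi>, C ?\<xi>} \<and> {?\<xi>, C ?\<xi>} \<subseteq> UNIV \<and> 1 / real (Suc n) > 0" by simp
        ultimately show ?thesis unfolding sstar_closure_def by blast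
      qed
      then obtain B where B: "\<And>n. B n \<in> bclos UNIV D ` Mb D M"
        "\<And>n \<xi>. \<xi> \<in> {?\<xi>, C ?\<xi>} \<Longrightarrow> norm (A \<xi> - B n \<xi>) + norm (badj UNIV (\<lambda>x. A x - B n x) \<xi>) < 1 / real (Suc n)"
        by metis
      have lim: "(\<lambda>n. B n \<xi>) \<longlonglongrightarrow> A \<xi>" if \<xi>: "\<xi> \<in> {?\<xi>, C ?\<xi>}" for \<xi>
      proof (rule LIM_zero_cancel, rule Lim_null_comparison[OF _ lim_1_over_n])
        \<comment> \<open>The approximants are within 1/(n+1), while \<open>lim_1_over_n\<close>
          concerns 1/n, whose value at n = 0 is zero; hence the restriction to positive n.\<close>
        have "norm (B n \<xi> - A \<xi>) \<le> 1 / real n" if "n > 0" for n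
        proof -
          have "norm (B n \<xi> - A \<xi>) \<le> 1 / real (Suc n)"
            using B(2)[OF \<xi>, of n] norm_ge_zero[of "badj UNIV (\<lambda>x. A x - B n x) \<xi>"]
            by (simp only: norm_minus_commute[of "B n \<xi>"])
          also have "\<dots> \<le> 1 / real n" using that by (simp add: frac_le)
          finally show ?thesis .
        qed
        then show "eventually (\<lambda>n. norm (B n \<xi> - A \<xi>) \<le> 1 / real n) sequentially"
          using eventually_gt_at_top[of 0] by (rule eventually_mono[rotated]) auto
      qed
      show "C0 (E (A (E x))) = E (A (C0 x))"
      proof (rule eq_on_ED)
        show "C0 (E (A (E x))) \<in> range E" "E (A (C0 x)) \<in> range E" using Cr by (auto simp: C0_def)
        fix \<eta> assume \<eta>: "\<eta> \<in> E ` D"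
        have "(\<lambda>n. cinner (C0 (E (B n ?\<xi>))) \<eta>) \<longlonglongrightarrow> cinner (C0 (E (A ?\<xi>))) \<eta>"
          by (intro tendsto_cinner bop_UNIV_tendsto[OF bC0] bop_UNIV_tendsto[OF bE] lim tendsto_const) simp
        moreover have "(\<lambda>n. cinner (E (B n (C ?\<xi>))) \<eta>) \<longlonglongrightarrow> cinner (E (A (C ?\<xi>))) \<eta>"
          by (intro tendsto_cinner bop_UNIV_tendsto[OF bE] lim tendsto_const) simp
        moreover have "cinner (C0 (E (B n ?\<xi>))) \<eta> = cinner (E (B n (C ?\<xi>))) \<eta>" for n
          using Mbcom[OF B(1) _ \<eta>, of ?\<xi> n] x by (simp add: C0_def E_idem)
        ultimately show "cinner (C0 (E (A (E x)))) \<eta> = cinner (E (A (C0 x))) \<eta>"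
          by (simp add: LIMSEQ_unique C0_def)
      qed
    qed (rule bop_UNIV_comp[OF bC0 bop_UNIV_comp[OF bE bop_UNIV_comp[OF bA bE]]]
        bop_UNIV_comp[OF bE bop_UNIV_comp[OF bA bC0]])+
    then show ?thesis by metis
  qed
  \<comment> \<open>\<open>?N\<close> is closed under products and adjoints and contains the
    identity, being the commutant of a set that is stable under adjoints.\<close>
  have "\<exists>T\<in>bcomm UNIV ?N. \<forall>x. T (E x) = C0 x"
    by (rule reduced_commutant_extension)
      (use bcomm_bop bcomm_id bcomm_comp bcomm_badj[OF wcomm_bop wcomm_badj[OF O]]
        bE E_idem cinner_E bC0 EC0 C0E comm in auto)
  then show ?thesis using wcomm_bicommutant[OF GW] by (auto simp: C0_def)
qed

text \<open>On E D the operator \<open>C\<close> agrees with a lift \<open>T\<close> in M'_w.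
  \<open>T\<close> maps \<open>D\<close> into \<open>D\<close> and commutes with \<open>E\<close>,
  so it maps E D into E D.\<close>

lemma wcomm_ME_invariant:
  assumes sd: "bcomm UNIV (wcomm UNIV D M) \<subseteq> sstar_closure UNIV (bclos UNIV D ` Mb D M)"
    and C: "C \<in> wcomm (range E) (E ` D) (ME D E M)"
  shows "C ` (E ` D) \<subseteq> E ` D"
proof -
  obtain T where T: "T \<in> wcomm UNIV D M" "\<And>x. T (E x) = C (E x)"
    using wcomm_ME_extends[OF sd C] by blast
  have "C (E x) \<in> E ` D" if "x \<in> D" for x
    using wcomm_commutes_E[OF T(1), of x] T(2)[of x] wcomm_intertwines(1)[OF GW T(1) EM that] by (metis imageI)
  then show ?thesis by auto
qed

end

theorem theorem2p4:
  fixes M :: "('a::chilbert \<Rightarrow> 'a) set" and D :: "'a set" and E :: "'a \<Rightarrow> 'a"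
  assumes "GWstar UNIV D M"
    and "sstar_closure UNIV (bclos UNIV D ` Mb D M) = bcomm UNIV (wcomm UNIV D M)"
    and "is_projection UNIV E"
    and "restr D E \<in> M"
  shows "GWstar (range E) (Dtilde (ME D E M) (E ` D)) (closure_alg (ME D E M) (E ` D))"
proof -
  interpret GWstar_projection M D E using assms by unfold_locales
  have "closure_alg (ME D E M) (E ` D) = ME D E M"
    by (rule closure_alg_closed_O[OF closed_ME]) (use OstarD(2)[OF Ostar_ME] in \<open>auto simp: Ldag_def\<close>)
  then show ?thesis
    unfolding Dtilde_closed_O[OF closed_ME] GWstar_def
    using Ostar_ME closed_ME ME_bicommutant wcomm_ME_invariant assms(2) by auto
qed

end
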